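(* Let $\mathbb K$ be a field, $R=\mathbb K[x_1,\dots,x_n]$, let $I=(m_1,\dots,m_q)\subseteq R$ be a monomial ideal and consider the ideal $J=(m_1,\dots,m_{q-1})\subset R$. If $I$ admits a minimal pruned resolution (with respect to the order $m_1,\dots,m_q$ of the generators) where no pruning has been performed at the $q$-th step of the pruning algorithm, then $J$ has a minimal pruned resolution.
   Context: $m_1,\dots,m_q$ are the minimal monomial generators of $I$. For a monomial ideal with minimal generators in a fixed order $m_1,\dots,m_q$ and $\sigma\subseteq\{1,\dots,q\}$ put $m_\sigma=\mathrm{lcm}(m_i: i\in\sigma)$, $m_\emptyset=1$. The Taylor resolution of $R/I$ is supported on the full simplex $X_{\mathrm{Taylor}}$ on $q$ vertices; the face $\sigma$ has homological degree $|\sigma|$ and multidegree the exponent of $m_\sigma$. Pruning algorithm: for $j=1,\dots,q$ successively (step $j$), for every $\sigma\not\ni j$ with $m_\sigma=m_{\sigma\cup\{j\}}$ and such that neither $\sigma$ nor $\sigma\cup\{j\}$ belongs to a previously selected edge, select (prune) the edge $\{\sigma,\sigma\cup\{j\}\}$. The selected edges form a homogeneous acyclic matching on $X_{\mathrm{Taylor}}$, and discrete Morse theory (Batzies–Welker) yields a $\mathbb Z^n$-graded CW-complex, with cells corresponding to the faces in no selected edge (critical faces), supporting a free resolution of $R/I$: the pruned resolution for the given order. Its module in homological degree $i$ is the direct sum of $R(-\deg m_\sigma)$ over critical $\sigma$ with $|\sigma|=i$; so it is minimal iff, for all $i,\alpha$, the number of critical $\sigma$ with $|\sigma|=i$ and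 multidegree $\alpha$ equals the multigraded Betti number $\beta_{i,\alpha}(R/I)$. A monomial ideal admits (has) a minimal pruned resolution if there is an order of its minimal generators for which the pruned resolution is minimal. *)

theory Defs
  imports Complex_Main "HOL-Library.Poly_Mapping" "HOL-Library.Function_Algebras"
begin

text \<open>
  The polynomial ring over the field \<open>'k\<close> in finitely many variables, indexed by \<open>'n\<close>, is the
  monoid algebra \<open>('n \<Rightarrow>\<^sub>0 nat) \<Rightarrow>\<^sub>0 'k\<close>. A monomial is represented by its exponent vector, so that
  products of monomials are sums of exponents, and the monomial \<open>1\<close> is \<open>0\<close>.
\<close>

type_synonym 'n mon = "'n \<Rightarrow>\<^sub>0 nat"
type_synonym ('n, 'k) mpol = "('n \<Rightarrow>\<^sub>0 nat) \<Rightarrow>\<^sub>0 'k"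

definition monomial_ideal :: "'n mon set \<Rightarrow> ('n, 'k::field) mpol set" where
  "monomial_ideal M = module.span (*) ((\<lambda>t. Poly_Mapping.single t 1) ` M)"

definition minimal_generators :: "'n mon list \<Rightarrow> ('n, 'k::field) mpol set \<Rightarrow> bool" where
  "minimal_generators ms I \<longleftrightarrow>
     distinct ms \<and> monomial_ideal (set ms) = I \<and> (\<forall>S. S \<subset> set ms \<longrightarrow> monomial_ideal S \<noteq> I)"

text \<open>
  A complex \<open>\<dots> \<rightarrow> F\<^sub>1 \<rightarrow> F\<^sub>0 \<rightarrow> R/I\<close> of finitely generated free multigraded modules, given by
  homogeneous bases and matrices. The basis of \<open>F\<^sub>i\<close> is indexed by \<open>basis F i\<close>, the basis element
  \<open>e\<close> of \<open>F\<^sub>i\<close> has multidegree \<open>mdeg F i e\<close>, the matrix \<open>bd F i\<close> (row index in \<open>basis F i\<close>, column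
  index in \<open>basis F (Suc i)\<close>) represents \<open>F\<^bsub>i+1\<^esub> \<rightarrow> F\<^sub>i\<close>, and \<open>aug F e\<close> is a representative in \<open>R\<close>
  of the image of \<open>e\<close> under \<open>F\<^sub>0 \<rightarrow> R/I\<close>. Multidegrees are taken to be nonnegative, which is harmless:
  such resolutions of \<open>R/I\<close> exist, and the Betti numbers below do not depend on the resolution.
\<close>

record (overloaded) ('n, 'k) graded_complex =
  basis :: "nat \<Rightarrow> nat set"
  mdeg :: "nat \<Rightarrow> nat \<Rightarrow> 'n mon"
  bd :: "nat \<Rightarrow> nat \<Rightarrow> nat \<Rightarrow> ('n, 'k) mpol"
  aug :: "nat \<Rightarrow> ('n, 'k) mpol"

definition graded_free_resolution ::
    "('n, 'k::field) graded_complex \<Rightarrow> ('n, 'k) mpol set \<Rightarrow> bool" where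
  "graded_free_resolution F I \<longleftrightarrow>
     (\<forall>i. finite (basis F i)) \<and>
     \<comment> \<open>the maps are homogeneous of degree \<open>0\<close>\<close>
     (\<forall>i. \<forall>a\<in>basis F i. \<forall>b\<in>basis F (Suc i). \<forall>t\<in>Poly_Mapping.keys (bd F i a b).
        mdeg F i a + t = mdeg F (Suc i) b) \<and>
     (\<forall>e\<in>basis F 0. Poly_Mapping.keys (aug F e) \<subseteq> {mdeg F 0 e}) \<and>
     \<comment> \<open>exactness at \<open>R/I\<close>, at \<open>F\<^sub>0\<close> and at \<open>F\<^bsub>i+1\<^esub>\<close>\<close>
     (\<forall>p. \<exists>v. p - (\<Sum>e\<in>basis F 0. v e * aug F e) \<in> I) \<and>
     (\<forall>v. (\<Sum>e\<in>basis F 0. v e * aug F e) \<in> I \<longleftrightarrow>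
        (\<exists>w. \<forall>a\<in>basis F 0. v a = (\<Sum>b\<in>basis F (Suc 0). bd F 0 a b * w b))) \<and>
     (\<forall>i v. (\<forall>a\<in>basis F i. (\<Sum>b\<in>basis F (Suc i). bd F i a b * v b) = 0) \<longleftrightarrow>
        (\<exists>w. \<forall>b\<in>basis F (Suc i).
           v b = (\<Sum>c\<in>basis F (Suc (Suc i)). bd F (Suc i) b c * w c)))"

text \<open>
  The component of multidegree \<open>\<alpha>\<close> of \<open>F\<^sub>i \<otimes> K\<close>, with \<open>K = R/(x\<^sub>1,\<dots>,x\<^sub>n)\<close>, is the \<open>K\<close>-vector space on
  the basis elements of \<open>F\<^sub>i\<close> of multidegree \<open>\<alpha>\<close>; the differential of \<open>F \<otimes> K\<close> is given by the
  constant terms of the matrix entries. Its homology is \<open>Tor\<^sub>i(R/I, K)\<^sub>\<alpha>\<close>.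
\<close>

definition basis_at :: "('n, 'k) graded_complex \<Rightarrow> nat \<Rightarrow> 'n mon \<Rightarrow> nat set" where
  "basis_at F i \<alpha> = {e \<in> basis F i. mdeg F i e = \<alpha>}"

definition tor_chains :: "('n, 'k::field) graded_complex \<Rightarrow> nat \<Rightarrow> 'n mon \<Rightarrow> (nat \<Rightarrow> 'k) set" where
  "tor_chains F i \<alpha> = {v. \<forall>e. e \<notin> basis_at F i \<alpha> \<longrightarrow> v e = 0}"

definition tor_bd ::
    "('n, 'k::field) graded_complex \<Rightarrow> nat \<Rightarrow> 'n mon \<Rightarrow> (nat \<Rightarrow> 'k) \<Rightarrow> (nat \<Rightarrow> 'k)" where
  "tor_bd F i \<alpha> v =
     (\<lambda>a. if a \<in> basis_at F i \<alpha>
          then \<Sum>b\<in>basis_at F (Suc i) \<alpha>. Poly_Mapping.lookup (bd F i a b) 0 * v b else 0)"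

definition tor_cycles :: "('n, 'k::field) graded_complex \<Rightarrow> nat \<Rightarrow> 'n mon \<Rightarrow> (nat \<Rightarrow> 'k) set" where
  "tor_cycles F i \<alpha> =
     {v \<in> tor_chains F i \<alpha>. case i of 0 \<Rightarrow> True | Suc j \<Rightarrow> tor_bd F j \<alpha> v = 0}"

definition tor_boundaries ::
    "('n, 'k::field) graded_complex \<Rightarrow> nat \<Rightarrow> 'n mon \<Rightarrow> (nat \<Rightarrow> 'k) set" where
  "tor_boundaries F i \<alpha> = tor_bd F i \<alpha> ` tor_chains F (Suc i) \<alpha>"

definition tor_dim :: "('n, 'k::field) graded_complex \<Rightarrow> nat \<Rightarrow> 'n mon \<Rightarrow> nat" where
  "tor_dim F i \<alpha> =
     vector_space.dim (\<lambda>c v e. c * v e) (tor_cycles F i \<alpha>) -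
     vector_space.dim (\<lambda>c v e. c * v e) (tor_boundaries F i \<alpha>)"

text \<open>
  \<open>betti I i \<alpha>\<close> is the multigraded Betti number \<open>\<beta>\<^bsub>i,\<alpha>\<^esub>(R/I) = dim\<^sub>K Tor\<^sub>i(R/I, K)\<^sub>\<alpha>\<close>, that is, the
  number of basis elements of multidegree \<open>\<alpha>\<close> in homological degree \<open>i\<close> of a minimal
  multigraded free resolution of \<open>R/I\<close>. It is computed from any multigraded free resolution.
\<close>

definition betti :: "('n, 'k::field) mpol set \<Rightarrow> nat \<Rightarrow> 'n mon \<Rightarrow> nat" where
  "betti I i \<alpha> = (THE d. \<exists>F. graded_free_resolution F I \<and> d = tor_dim F i \<alpha>)"

text \<open>
  The generators \<open>m\<^sub>1, \<dots>, m\<^sub>q\<close> are \<open>ms ! 0, \<dots>, ms ! (q - 1)\<close>, so step \<open>j\<close> of the algorithm in its usual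
  numbering is \<open>prune_step ms (j - 1)\<close> below.
\<close>

definition lcm_mon :: "('n::finite) mon list \<Rightarrow> nat set \<Rightarrow> 'n mon" where
  "lcm_mon ms \<sigma> =
     Abs_poly_mapping (\<lambda>x. Max (insert 0 ((\<lambda>i. Poly_Mapping.lookup (ms ! i) x) ` \<sigma>)))"

lemma lookup_lcm_mon:
  "Poly_Mapping.lookup (lcm_mon ms \<sigma>) x =
     Max (insert 0 ((\<lambda>i. Poly_Mapping.lookup (ms ! i) x) ` \<sigma>))"
  unfolding lcm_mon_def by (subst Abs_poly_mapping_inverse) auto

text \<open>
  \<open>new_edges ms j E\<close> are the edges selected when treating the generator \<open>ms ! j\<close>, where \<open>E\<close> is the
  set of edges selected before. (Edges \<open>{\<sigma>, \<sigma> \<union> {j}}\<close> for the same \<open>j\<close> are pairwise disjoint, so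
  it does not matter in which order the \<open>\<sigma>\<close> are treated.)
\<close>

definition new_edges :: "('n::finite) mon list \<Rightarrow> nat \<Rightarrow> nat set set set \<Rightarrow> nat set set set" where
  "new_edges ms j E =
     {{\<sigma>, insert j \<sigma>} | \<sigma>. \<sigma> \<subseteq> {..<length ms} \<and> j \<notin> \<sigma> \<and>
        lcm_mon ms \<sigma> = lcm_mon ms (insert j \<sigma>) \<and> \<sigma> \<notin> \<Union>E \<and> insert j \<sigma> \<notin> \<Union>E}"

primrec pruned_before :: "('n::finite) mon list \<Rightarrow> nat \<Rightarrow> nat set set set" where
  "pruned_before ms 0 = {}"
| "pruned_before ms (Suc j) = pruned_before ms j \<union> new_edges ms j (pruned_before ms j)"

definition prune_step :: "('n::finite) mon list \<Rightarrow> nat \<Rightarrow> nat set set set" where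
  "prune_step ms j = new_edges ms j (pruned_before ms j)"

definition critical_faces :: "('n::finite) mon list \<Rightarrow> nat set set" where
  "critical_faces ms = Pow {..<length ms} - \<Union>(pruned_before ms (length ms))"

text \<open>
  The module in homological degree \<open>i\<close> of the pruned resolution for the order \<open>ms\<close> is the direct sum
  of the \<open>R(-deg m\<^sub>\<sigma>)\<close> over the critical \<open>\<sigma>\<close> with \<open>i\<close> elements.
\<close>

definition pruned_resolution_minimal ::
    "('n::finite) mon list \<Rightarrow> ('n, 'k::field) mpol set \<Rightarrow> bool" where
  "pruned_resolution_minimal ms I \<longleftrightarrow>
     (\<forall>i \<alpha>. card {\<sigma> \<in> critical_faces ms. card \<sigma> = i \<and> lcm_mon ms \<sigma> = \<alpha>} = betti I i \<alpha>)"

definition has_minimal_pruned_resolution :: "('n::finite, 'k::field) mpol set \<Rightarrow> bool" where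
  "has_minimal_pruned_resolution I \<longleftrightarrow>
     (\<exists>ms. minimal_generators ms I \<and> pruned_resolution_minimal ms I)"

end

theory Submission
  imports Defs "HOL-Library.Nat_Bijection"
begin

text \<open>
  In each multidegree \<open>\<beta>\<close> a multigraded free complex is a complex of finite-dimensional vector spaces,
  its strand; it is a resolution iff all strands are exact, and comparing two resolutions strandwise
  shows that the Betti numbers may be computed from the Taylor resolution. There, in multidegree
  \<open>\<alpha>\<close>, both the Betti numbers and the numbers of critical faces are obtained from the
  numbers of all faces: by subtracting the ranks \<open>r\<^sub>i\<close> of the differentials, respectively the numbers
  \<open>e\<^sub>i\<close> of selected edges. Since the matching is acyclic, \<open>e\<^sub>i \<le> r\<^sub>i\<close>, and the pruned resolution is
  minimal iff \<open>e\<^sub>i = r\<^sub>i\<close> throughout.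

  If nothing is pruned at step \<open>q\<close>, the edges for \<open>I\<close> are those for \<open>J\<close> together with edges between
  faces containing \<open>q\<close>. The differential is block triangular with respect to this splitting of the
  faces, so its rank for \<open>I\<close> is at least its rank for \<open>J\<close> plus the number of edges of the second kind.
  Hence equality for \<open>I\<close> forces equality for \<open>J\<close>.
\<close>

text \<open>\<open>betti\<close> is a definite description ranging over all resolutions, so nothing
  can be computed from it until one resolution is exhibited and any two are shown to give the same
  \<open>tor_dim\<close>. This is why a comparison theorem and the exactness of the Taylor complex
  precede the combinatorics. No Morse complex is constructed. All that is used of the matching is
  that the submatrix of the differential with the upper ends of selected edges as columns and the
  lower ends as rows is triangular in a suitable order, with 1 or -1 on the diagonal. It is
  invertible over every field, whence e_i \<le> r_i. Minimality then gives e_i = r_i without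
  induction on i: the face counts yield r_{i-1} + r_i = e_{i-1} + e_i, and two inequalities that add
  up to an equality are equalities. The splitting depends on step q being empty: an edge whose upper
  end contains q then has a lower end that still contains q, and boundaries of faces avoiding q have
  coefficient 0 there.\<close>

subsection \<open>Dimensions of subspaces\<close>

text \<open>Independence of the classes of the \<open>x s\<close> in V/W, expressed without quotient
  spaces: a basis of W stays independent when the \<open>x s\<close> are adjoined one at a time. A
  nonzero W is what later allows the rank for J to be added to the number of remaining edges. The
  finite set X replaces finite dimension of the ambient space.\<close>

lemma (in vector_space) dim_relative_le:
  assumes W: "subspace W" "W \<subseteq> V" and V: "V \<subseteq> span X" "finite X"
    and S: "finite S" "x ` S \<subseteq> V"
    and indep: "\<And>a. (\<Sum>s\<in>S. a s *s x s) \<in> W \<Longrightarrow> \<forall>s\<in>S. a s = 0"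
  shows "dim W + card S \<le> dim V"
proof -
  obtain B where B: "B \<subseteq> W" "independent B" "W \<subseteq> span B" "card B = dim W"
    using basis_exists by blast
  obtain C where C: "C \<subseteq> V" "independent C" "V \<subseteq> span C" "card C = dim V"
    using basis_exists by blast
  have finC: "finite C"
    using independent_span_bound[OF V(2) C(2)] C(1) V(1) by blast
  have finB: "finite B"
    using independent_span_bound[OF V(2) B(2)] B(1) W(2) V(1) by blast
  have spanB: "span B \<subseteq> W"
    using B(1) W(1) span_minimal by blast
  have "inj_on x S"
  proof (rule inj_onI, rule ccontr)
    fix s t assume st: "s \<in> S" "t \<in> S" "x s = x t" "s \<noteq> t"
    define a where "a r = (if r = s then 1 else if r = t then - 1 else (0::'a))" for r
    have "(\<Sum>r\<in>S. a r *s x r) = (\<Sum>r\<in>{s, t}. a r *s x r)"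
      using S(1) st by (intro sum.mono_neutral_right) (auto simp: a_def)
    also have "\<dots> = 0" using st by (simp add: a_def)
    finally have "(\<Sum>r\<in>S. a r *s x r) \<in> W"
      using W(1) by (simp add: subspace_0)
    from indep[OF this] st show False by (auto simp: a_def)
  qed
  have "independent (B \<union> x ` T) \<and> card (B \<union> x ` T) = card B + card T" if "finite T" "T \<subseteq> S" for T
    using that
  proof (induction T rule: finite_induct)
    case empty
    then show ?case using B by simp
  next
    case (insert s T)
    have notin: "x s \<notin> span (B \<union> x ` T)"
    proof
      assume "x s \<in> span (B \<union> x ` T)"
      then obtain u v where uv: "x s = u + v" "u \<in> span B" "v \<in> span (x ` T)"
        by (auto simp: span_Un)
      then obtain f where f: "v = (\<Sum>y\<in>x ` T. f y *s y)"
        using insert.hyps(1) by (auto simp: span_finite)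
      define a where "a r = (if r = s then 1 else if r \<in> T then - f (x r) else 0)" for r
      have "inj_on x T"
        using \<open>inj_on x S\<close> insert.prems inj_on_subset by blast
      then have v: "v = (\<Sum>t\<in>T. f (x t) *s x t)"
        by (simp add: f sum.reindex)
      have "(\<Sum>r\<in>S. a r *s x r) = (\<Sum>r\<in>insert s T. a r *s x r)"
        using S(1) insert.prems by (intro sum.mono_neutral_right) (auto simp: a_def)
      also have "\<dots> = x s + (\<Sum>r\<in>T. - (f (x r) *s x r))"
        using insert.hyps by (auto simp: a_def intro!: sum.cong)
      also have "\<dots> = u" by (simp add: uv(1) v sum_negf)
      finally have "(\<Sum>r\<in>S. a r *s x r) \<in> W" using uv(2) spanB by auto
      from indep[OF this] insert.prems show False by (auto simp: a_def)
    qed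
    have new: "x s \<notin> B \<union> x ` T" by (rule contra_subsetD[OF span_superset notin])
    have IH: "independent (B \<union> x ` T)" "card (B \<union> x ` T) = card B + card T"
      using insert.IH insert.prems by auto
    have eq: "B \<union> x ` insert s T = insert (x s) (B \<union> x ` T)" by auto
    have "card (insert (x s) (B \<union> x ` T)) = Suc (card (B \<union> x ` T))"
      using new finB insert.hyps(1) by (intro card_insert_disjoint) auto
    moreover have "independent (insert (x s) (B \<union> x ` T))"
      using notin IH(1) by (rule independent_insertI)
    ultimately show ?case
      unfolding eq using IH(2) insert.hyps by simp
  qed
  from this[OF S(1)] have I: "independent (B \<union> x ` S)" "card (B \<union> x ` S) = card B + card S"
    by auto
  have "B \<union> x ` S \<subseteq> span C" using B(1) W(2) S(2) C(3) by blast
  from independent_span_bound[OF finC I(1) this] show ?thesis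
    using I(2) B(4) C(4) by simp
qed

lemma (in vector_space) dim_subspace_mono:
  assumes "subspace W" "W \<subseteq> V" "V \<subseteq> span X" "finite X"
  shows "dim W \<le> dim V"
  using dim_relative_le[OF assms, of "{}"] by simp

text \<open>Preimages \<open>x c\<close> of a basis of the image are independent modulo the kernel,
  which bounds \<open>dim V\<close> from below; together with a basis of the kernel they span V,
  which bounds it from above.\<close>

lemma (in vector_space) rank_nullity:
  assumes f: "Vector_Spaces.linear scale scale f" and V: "subspace V" "V \<subseteq> span X" "finite X"
  shows "dim {v \<in> V. f v = 0} + dim (f ` V) = dim V"
proof -
  interpret p: vector_space_pair scale scale by unfold_locales
  let ?K = "{v \<in> V. f v = 0}"
  have K: "subspace ?K"
    using V(1) by (auto simp: subspace_def p.linear_0[OF f] p.linear_add[OF f] p.linear_scale[OF f])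
  obtain C where C: "C \<subseteq> f ` V" "independent C" "f ` V \<subseteq> span C" "card C = dim (f ` V)"
    using basis_exists by blast
  obtain B where B: "B \<subseteq> ?K" "independent B" "?K \<subseteq> span B" "card B = dim ?K"
    using basis_exists by blast
  have "f ` V \<subseteq> span (f ` X)"
    using V(2) p.linear_span_image[OF f, of X] by blast
  then have finC: "finite C"
    using independent_span_bound[of "f ` X" C] C V(3) by blast
  have finB: "finite B"
    using independent_span_bound[OF V(3) B(2)] B(1) V(2) by blast
  have "\<forall>c\<in>C. \<exists>v. v \<in> V \<and> f v = c"
    using C(1) by auto
  then obtain x where "\<forall>c\<in>C. x c \<in> V \<and> f (x c) = c"
    unfolding bchoice_iff by blast
  then have x: "\<And>c. c \<in> C \<Longrightarrow> x c \<in> V \<and> f (x c) = c"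
    by blast
  have fsum: "f (\<Sum>c\<in>C. a c *s x c) = (\<Sum>c\<in>C. a c *s c)" for a
    using x by (simp add: p.linear_sum[OF f] p.linear_scale[OF f])
  have "dim ?K + card C \<le> dim V"
  proof (rule dim_relative_le[OF K _ V(2,3) finC, where x = x])
    fix a assume "(\<Sum>c\<in>C. a c *s x c) \<in> ?K"
    then have "(\<Sum>c\<in>C. a c *s c) = 0" by (simp add: fsum)
    then show "\<forall>c\<in>C. a c = 0"
      using independentD[OF C(2) finC] by blast
  qed (use x in auto)
  moreover have "V \<subseteq> span (B \<union> x ` C)"
  proof
    fix v assume v: "v \<in> V"
    then obtain a where a: "f v = (\<Sum>c\<in>C. a c *s c)"
      using C(3) finC by (auto simp: span_finite)
    let ?w = "\<Sum>c\<in>C. a c *s x c"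
    have w: "?w \<in> V" using x by (intro subspace_sum V(1) subspace_scale) auto
    have "v - ?w \<in> ?K"
      using v w V(1) by (auto simp: subspace_diff p.linear_diff[OF f] fsum a)
    then have 1: "v - ?w \<in> span (B \<union> x ` C)"
      using B(3) span_mono by blast
    have 2: "?w \<in> span (B \<union> x ` C)"
      by (intro span_sum span_scale span_base) auto
    show "v \<in> span (B \<union> x ` C)"
      using span_add[OF 1 2] by simp
  qed
  then have "dim V \<le> card (B \<union> x ` C)"
    using finB finC by (intro dim_le_card) auto
  moreover have "card (B \<union> x ` C) \<le> card B + card C"
    by (meson card_Un_le card_image_le finC add_left_mono order_trans)
  ultimately show ?thesis using B(4) C(4) by simp
qed

text \<open>The scalar multiplication is written literally as in \<open>tor_dim\<close>, so
  \<open>fv.dim\<close> is the dimension occurring there. All chains are functions on the naturals,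
  hence one space serves as source and target of every map.\<close>

interpretation fv: vector_space "\<lambda>(c::'k::field) (v::nat \<Rightarrow> 'k) e. c * v e"
  by unfold_locales (auto simp: fun_eq_iff algebra_simps)

interpretation fp: vector_space_pair "\<lambda>(c::'k::field) (v::nat \<Rightarrow> 'k) e. c * v e"
    "\<lambda>(c::'k::field) (v::nat \<Rightarrow> 'k) e. c * v e"
  by unfold_locales

abbreviation lin :: "((nat \<Rightarrow> 'k) \<Rightarrow> (nat \<Rightarrow> 'k::field)) \<Rightarrow> bool" where
  "lin \<equiv> Vector_Spaces.linear (\<lambda>c v e. c * v e) (\<lambda>c v e. c * v e)"

section \<open>Coordinate subspaces\<close>

definition supported_on :: "nat set \<Rightarrow> (nat \<Rightarrow> 'k::field) set" where
  "supported_on A = {v. \<forall>e. e \<notin> A \<longrightarrow> v e = 0}"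

definition unit_vec :: "nat \<Rightarrow> nat \<Rightarrow> 'k::field" where
  "unit_vec e = (\<lambda>x. if x = e then 1 else 0)"

lemma linI:
  assumes "\<And>u v. L (u + v) = L u + L v" and "\<And>c v. L (\<lambda>e. c * v e) = (\<lambda>e. c * L v e)"
  shows "lin L"
  by (simp add: Vector_Spaces.linear_iff fv.vector_space_axioms assms)

lemma sum_fun_apply: "(\<Sum>i\<in>A. f i) x = (\<Sum>i\<in>A. f i x)"
  by (induction A rule: infinite_finite_induct) auto

lemma sum_unit_vec:
  assumes "finite A"
  shows "(\<Sum>e\<in>A. a e * unit_vec e x) = (if x \<in> A then a x else 0)"
proof -
  have "(\<Sum>e\<in>A. a e * unit_vec e x) = (\<Sum>e\<in>A. if x = e then a e else 0)"
    by (intro sum.cong) (auto simp: unit_vec_def)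
  then show ?thesis using assms by simp
qed

lemma subspace_supported_on: "fv.subspace (supported_on A)"
  by (auto simp: fv.subspace_def supported_on_def)

lemma supported_on_expand:
  assumes "finite A" "v \<in> supported_on A"
  shows "v = (\<Sum>e\<in>A. (\<lambda>x. v e * unit_vec e x))"
  using assms by (auto simp: fun_eq_iff sum_fun_apply supported_on_def sum_unit_vec)

lemma supported_on_span:
  assumes "finite A"
  shows "supported_on A \<subseteq> fv.span (unit_vec ` A :: (nat \<Rightarrow> 'k::field) set)"
proof
  fix v :: "nat \<Rightarrow> 'k" assume "v \<in> supported_on A"
  then have "v = (\<Sum>e\<in>A. (\<lambda>x. v e * unit_vec e x))"
    using supported_on_expand assms by blast
  also have "\<dots> \<in> fv.span (unit_vec ` A)"
    by (intro fv.span_sum fv.span_scale fv.span_base) auto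
  finally show "v \<in> fv.span (unit_vec ` A)" .
qed

lemma dim_supported_on:
  assumes "finite A"
  shows "fv.dim (supported_on A :: (nat \<Rightarrow> 'k::field) set) = card A"
proof (rule antisym)
  show "fv.dim (supported_on A :: (nat \<Rightarrow> 'k) set) \<le> card A"
    using fv.dim_le_card[OF supported_on_span[OF assms, where 'k = 'k]] card_image_le[OF assms]
    by (meson assms finite_imageI order_trans)
  have "fv.dim {0::nat \<Rightarrow> 'k} + card A \<le> fv.dim (supported_on A :: (nat \<Rightarrow> 'k) set)"
  proof (rule fv.dim_relative_le[OF _ _ supported_on_span[OF assms] _ assms, where x = unit_vec])
    fix a :: "nat \<Rightarrow> 'k" assume "(\<Sum>e\<in>A. (\<lambda>x. a e * unit_vec e x)) \<in> {0}"
    then have "(\<Sum>e\<in>A. a e * unit_vec e x) = 0" for x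
      by (auto simp: fun_eq_iff sum_fun_apply)
    then show "\<forall>e\<in>A. a e = 0"
      unfolding sum_unit_vec[OF assms] by meson
  qed (use assms in \<open>auto simp: supported_on_def unit_vec_def\<close>)
  then show "card A \<le> fv.dim (supported_on A :: (nat \<Rightarrow> 'k) set)" by simp
qed

subsection \<open>Strands and the comparison theorem\<close>

text \<open>Divisibility of monomials in additive notation. Subtraction of exponents is truncated,
  so a difference \<open>t - s\<close> is meaningful only under \<open>mdvd s t\<close>.\<close>

definition mdvd :: "'n mon \<Rightarrow> 'n mon \<Rightarrow> bool" where
  "mdvd s t \<longleftrightarrow> (\<exists>u. t = s + u)"

lemma mdvd_refl [simp]: "mdvd s s"
  unfolding mdvd_def by (rule exI[of _ 0]) simp

lemma mdvd_trans: "mdvd s t \<Longrightarrow> mdvd t u \<Longrightarrow> mdvd s u"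
  unfolding mdvd_def by (auto simp: add.assoc)

lemma mdvd_iff: "mdvd s t \<longleftrightarrow> (\<forall>x. Poly_Mapping.lookup s x \<le> Poly_Mapping.lookup t x)"
proof
  assume "\<forall>x. Poly_Mapping.lookup s x \<le> Poly_Mapping.lookup t x"
  then have "t = s + (t - s)"
    by (auto intro!: poly_mapping_eqI simp: lookup_add lookup_minus)
  then show "mdvd s t" unfolding mdvd_def by blast
qed (auto simp: mdvd_def lookup_add)

lemma mdvd_antisym: "mdvd s t \<Longrightarrow> mdvd t s \<Longrightarrow> s = t"
  by (auto simp: mdvd_iff intro!: poly_mapping_eqI antisym)

text \<open>A vector \<open>v\<close> in the strand stands for the element \<open>\<Sum>\<^sub>e v e x\<^bsup>\<beta> - mdeg e\<^esup> e\<close> of degree \<open>\<beta>\<close> of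
  \<open>F\<^sub>i\<close>; the matrix of the differential in these bases does not depend on \<open>\<beta>\<close>.\<close>

definition strand :: "('n, 'k::field) graded_complex \<Rightarrow> nat \<Rightarrow> 'n mon \<Rightarrow> (nat \<Rightarrow> 'k) set" where
  "strand F i \<beta> = supported_on {e \<in> basis F i. mdvd (mdeg F i e) \<beta>}"

text \<open>A homogeneous matrix entry is a scalar times the monomial whose exponent is the
  difference of the two multidegrees. This is that scalar, with value 0 if the difference is not an
  exponent vector.\<close>

definition coef :: "('n, 'k::field) graded_complex \<Rightarrow> nat \<Rightarrow> nat \<Rightarrow> nat \<Rightarrow> 'k" where
  "coef F i a b =
     (if mdvd (mdeg F i a) (mdeg F (Suc i) b)
      then Poly_Mapping.lookup (bd F i a b) (mdeg F (Suc i) b - mdeg F i a) else 0)"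

definition strand_bd :: "('n, 'k::field) graded_complex \<Rightarrow> nat \<Rightarrow> (nat \<Rightarrow> 'k) \<Rightarrow> (nat \<Rightarrow> 'k)" where
  "strand_bd F i v =
     (\<lambda>a. if a \<in> basis F i then \<Sum>b\<in>basis F (Suc i). coef F i a b * v b else 0)"

definition strand_aug :: "('n, 'k::field) graded_complex \<Rightarrow> (nat \<Rightarrow> 'k) \<Rightarrow> 'k" where
  "strand_aug F v = (\<Sum>e\<in>basis F 0. Poly_Mapping.lookup (aug F e) (mdeg F 0 e) * v e)"

text \<open>U stands for the degrees of the monomials in I: in such degrees R/I is zero and every
  vector of degree 0 is a cycle, while in all others R/I is one-dimensional and
  \<open>strand_aug\<close> is the map onto it.\<close>

definition strand_cycles ::
    "('n, 'k::field) graded_complex \<Rightarrow> 'n mon set \<Rightarrow> nat \<Rightarrow> 'n mon \<Rightarrow> (nat \<Rightarrow> 'k) set" where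
  "strand_cycles F U i \<beta> =
     {v \<in> strand F i \<beta>. case i of 0 \<Rightarrow> \<beta> \<in> U \<or> strand_aug F v = 0 | Suc j \<Rightarrow> strand_bd F j v = 0}"

definition strandwise_exact :: "('n, 'k::field) graded_complex \<Rightarrow> 'n mon set \<Rightarrow> bool" where
  "strandwise_exact F U \<longleftrightarrow>
     (\<forall>i. finite (basis F i)) \<and>
     (\<forall>\<beta>. \<beta> \<notin> U \<longrightarrow> (\<exists>v\<in>strand F 0 \<beta>. strand_aug F v = 1)) \<and>
     (\<forall>i \<beta>. strand_cycles F U i \<beta> = strand_bd F i ` strand F (Suc i) \<beta>)"

text \<open>In strand coordinates, multiplication by a monomial is an inclusion of strands. A single
  linear map respecting all strands therefore encodes a homogeneous R-linear map between free
  modules.\<close>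

definition graded_map ::
    "('n, 'k::field) graded_complex \<Rightarrow> nat \<Rightarrow> ('n, 'k) graded_complex \<Rightarrow> nat \<Rightarrow>
     ((nat \<Rightarrow> 'k) \<Rightarrow> (nat \<Rightarrow> 'k)) \<Rightarrow> bool" where
  "graded_map F i G j L \<longleftrightarrow> lin L \<and> (\<forall>\<beta>. \<forall>v\<in>strand F i \<beta>. L v \<in> strand G j \<beta>)"

lemma subspace_strand: "fv.subspace (strand F i \<beta>)"
  by (simp add: strand_def subspace_supported_on)

lemma strand_iff: "v \<in> strand F i \<beta> \<longleftrightarrow> (\<forall>e. v e \<noteq> 0 \<longrightarrow> e \<in> basis F i \<and> mdvd (mdeg F i e) \<beta>)"
  by (auto simp: strand_def supported_on_def)

lemma strand_mono: "mdvd \<alpha> \<beta> \<Longrightarrow> strand F i \<alpha> \<subseteq> strand F i \<beta>"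
  unfolding strand_iff subset_iff using mdvd_trans by metis

lemma unit_vec_strand: "e \<in> basis F i \<Longrightarrow> mdvd (mdeg F i e) \<beta> \<Longrightarrow> unit_vec e \<in> strand F i \<beta>"
  by (auto simp: strand_iff unit_vec_def)

lemma strand_expand:
  assumes "finite (basis F i)" "v \<in> strand F i \<beta>"
  shows "v = (\<Sum>e\<in>basis F i. (\<lambda>x. v e * unit_vec e x))"
  using assms by (intro supported_on_expand) (auto simp: strand_def supported_on_def)

lemma lin_comp: "lin L \<Longrightarrow> lin M \<Longrightarrow> lin (\<lambda>v. L (M v))"
  by (intro linI) (simp_all only: fp.linear_add fp.linear_scale)

lemma lin_diff: "lin L \<Longrightarrow> lin M \<Longrightarrow> lin (\<lambda>v. L v - M v)"
  by (intro linI) (simp_all add: fp.linear_add fp.linear_scale fun_eq_iff algebra_simps)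

lemma lin_strand_bd: "lin (strand_bd F i)"
  by (intro linI) (auto simp: strand_bd_def fun_eq_iff sum.distrib sum_distrib_left algebra_simps)

lemma strand_aug_scale: "strand_aug F (\<lambda>e. c * v e) = c * strand_aug F v"
  by (simp add: strand_aug_def sum_distrib_left algebra_simps)

lemma strand_aug_add: "strand_aug F (u + v) = strand_aug F u + strand_aug F v"
  by (simp add: strand_aug_def sum.distrib algebra_simps)

lemma strand_aug_0 [simp]: "strand_aug F 0 = 0"
  by (simp add: strand_aug_def)

lemma strand_aug_sum: "strand_aug F (\<Sum>i\<in>A. f i) = (\<Sum>i\<in>A. strand_aug F (f i))"
  unfolding strand_aug_def sum_fun_apply sum_distrib_left by (rule sum.swap)

lemma strand_aug_diff: "strand_aug F (u - v) = strand_aug F u - strand_aug F v"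
  using strand_aug_add[of F "u - v" v] by simp

section \<open>Graded maps, comparison and homotopy\<close>

lemma graded_mapD:
  assumes "graded_map F i G j L"
  shows "lin L" "v \<in> strand F i \<beta> \<Longrightarrow> L v \<in> strand G j \<beta>"
  using assms by (auto simp: graded_map_def)

lemma graded_map_comp:
  "graded_map G j H k L \<Longrightarrow> graded_map F i G j M \<Longrightarrow> graded_map F i H k (\<lambda>v. L (M v))"
  by (auto simp: graded_map_def lin_comp)

lemma graded_map_diff:
  "graded_map F i G j L \<Longrightarrow> graded_map F i G j M \<Longrightarrow> graded_map F i G j (\<lambda>v. L v - M v)"
  by (auto simp: graded_map_def lin_diff fv.subspace_diff[OF subspace_strand])

lemma graded_map_id: "graded_map F i F i (\<lambda>v. v)"
  by (auto simp: graded_map_def intro: linI)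

text \<open>A nonzero \<open>coef F i a b\<close> requires the multidegree of a to divide that of b,
  which divides \<beta> if b occurs in the vector.\<close>

lemma graded_map_strand_bd: "graded_map F (Suc i) F i (strand_bd F i)"
  unfolding graded_map_def
proof (intro conjI allI ballI)
  fix \<beta> v assume v: "v \<in> strand F (Suc i) \<beta>"
  show "strand_bd F i v \<in> strand F i \<beta>"
    unfolding strand_iff
  proof (intro allI impI)
    fix a assume a: "strand_bd F i v a \<noteq> 0"
    then have "a \<in> basis F i" by (rule contrapos_np) (simp add: strand_bd_def)
    moreover from this a have "(\<Sum>b\<in>basis F (Suc i). coef F i a b * v b) \<noteq> 0"
      by (simp add: strand_bd_def)
    then obtain b where "b \<in> basis F (Suc i)" "coef F i a b * v b \<noteq> 0"
      by (meson sum.neutral)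
    then have "b \<in> basis F (Suc i)" "mdvd (mdeg F i a) (mdeg F (Suc i) b)" "v b \<noteq> 0"
      by (simp_all add: coef_def split: if_splits)
    ultimately show "a \<in> basis F i \<and> mdvd (mdeg F i a) \<beta>"
      using v mdvd_trans unfolding strand_iff by blast
  qed
qed (rule lin_strand_bd)

text \<open>Freeness: images may be prescribed on basis elements. It suffices to place
  \<open>w e\<close> in the strand at the multidegree of e, because every strand in which e occurs
  lies above that one.\<close>

lemma graded_map_extend:
  fixes F G :: "('n, 'k::field) graded_complex"
  assumes w: "\<And>e. e \<in> basis F i \<Longrightarrow> w e \<in> strand G j (mdeg F i e)"
  shows "graded_map F i G j (\<lambda>v. \<Sum>e\<in>basis F i. (\<lambda>x. v e * w e x))"
  unfolding graded_map_def
proof (intro conjI allI ballI)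
  show "lin (\<lambda>v. \<Sum>e\<in>basis F i. (\<lambda>x. v e * w e x))"
  proof (rule linI)
    fix c :: 'k and u v :: "nat \<Rightarrow> 'k"
    show "(\<Sum>e\<in>basis F i. (\<lambda>x. (u + v) e * w e x)) =
        (\<Sum>e\<in>basis F i. (\<lambda>x. u e * w e x)) + (\<Sum>e\<in>basis F i. (\<lambda>x. v e * w e x))"
      by (rule ext) (simp add: sum_fun_apply distrib_right sum.distrib)
    show "(\<Sum>e\<in>basis F i. (\<lambda>x. (c * v e) * w e x)) =
        (\<lambda>x. c * (\<Sum>e\<in>basis F i. (\<lambda>x. v e * w e x)) x)"
      unfolding sum_fun_apply sum_distrib_left mult.assoc ..
  qed
  fix \<beta> and v :: "nat \<Rightarrow> 'k" assume v: "v \<in> strand F i \<beta>"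
  show "(\<Sum>e\<in>basis F i. (\<lambda>x. v e * w e x)) \<in> strand G j \<beta>"
  proof (intro fv.subspace_sum subspace_strand)
    fix e assume e: "e \<in> basis F i"
    show "(\<lambda>x. v e * w e x) \<in> strand G j \<beta>"
    proof (cases "v e = 0")
      case False
      then have "mdvd (mdeg F i e) \<beta>" using v unfolding strand_iff by blast
      then have "w e \<in> strand G j \<beta>" using w[OF e] strand_mono by blast
      then show ?thesis by (intro fv.subspace_scale subspace_strand)
    qed (simp add: strand_iff)
  qed
qed

lemma lin_expand:
  assumes "lin L" "finite (basis F i)" "v \<in> strand F i \<beta>"
  shows "L v = (\<Sum>e\<in>basis F i. (\<lambda>x. v e * L (unit_vec e) x))"
proof -
  have "L v = L (\<Sum>e\<in>basis F i. (\<lambda>x. v e * unit_vec e x))"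
    using strand_expand[OF assms(2,3)] by (rule arg_cong)
  then show ?thesis
    by (simp add: fp.linear_sum[OF assms(1)] fp.linear_scale[OF assms(1)])
qed

text \<open>Projectivity of free modules: lift the images of basis elements by exactness of G and
  extend linearly. Both the comparison map and the homotopy are built by repeating this
  step.\<close>

lemma graded_map_lift:
  fixes F G :: "('n, 'k::field) graded_complex"
  assumes G: "strandwise_exact G U" and fin: "finite (basis F i)" and h: "graded_map F i G j h"
    and cyc: "\<And>\<beta> v. v \<in> strand F i \<beta> \<Longrightarrow> h v \<in> strand_cycles G U j \<beta>"
  shows "\<exists>s. graded_map F i G (Suc j) s \<and> (\<forall>\<beta>. \<forall>v\<in>strand F i \<beta>. strand_bd G j (s v) = h v)"
proof -
  have "\<forall>e\<in>basis F i. \<exists>w. w \<in> strand G (Suc j) (mdeg F i e) \<and> strand_bd G j w = h (unit_vec e)"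
  proof
    fix e assume "e \<in> basis F i"
    then have "h (unit_vec e) \<in> strand_cycles G U j (mdeg F i e)"
      by (intro cyc unit_vec_strand) auto
    then show "\<exists>w. w \<in> strand G (Suc j) (mdeg F i e) \<and> strand_bd G j w = h (unit_vec e)"
      using G unfolding strandwise_exact_def by auto
  qed
  then obtain w where w: "\<And>e. e \<in> basis F i \<Longrightarrow>
      w e \<in> strand G (Suc j) (mdeg F i e) \<and> strand_bd G j (w e) = h (unit_vec e)"
    unfolding bchoice_iff by blast
  let ?s = "\<lambda>v. \<Sum>e\<in>basis F i. (\<lambda>x. v e * w e x)"
  have "strand_bd G j (?s v) = h v" if "v \<in> strand F i \<beta>" for v \<beta>
    using w lin_expand[OF graded_mapD(1)[OF h] fin that]
    by (simp add: fp.linear_sum[OF lin_strand_bd] fp.linear_scale[OF lin_strand_bd])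
  then show ?thesis using graded_map_extend w by blast
qed

lemma strand_cycles_subset: "strand_cycles F U i \<beta> \<subseteq> strand F i \<beta>"
  by (auto simp: strand_cycles_def)

lemma strand_bd_in_cycles:
  "strandwise_exact F U \<Longrightarrow> v \<in> strand F (Suc i) \<beta> \<Longrightarrow> strand_bd F i v \<in> strand_cycles F U i \<beta>"
  unfolding strandwise_exact_def by auto

text \<open>The usual lifting of the identity of R/I to a chain map, degree by degree. Compatibility
  with the augmentation is required only outside U, where R/I is nonzero.\<close>

lemma comparison_map:
  fixes F G :: "('n, 'k::field) graded_complex"
  assumes F: "strandwise_exact F U" and G: "strandwise_exact G U"
    and U: "\<And>s t. s \<in> U \<Longrightarrow> mdvd s t \<Longrightarrow> t \<in> U"
  shows "\<exists>\<phi>. (\<forall>i. graded_map F i G i (\<phi> i)) \<and>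
    (\<forall>i \<beta>. \<forall>v\<in>strand F (Suc i) \<beta>. strand_bd G i (\<phi> (Suc i) v) = \<phi> i (strand_bd F i v)) \<and>
    (\<forall>\<beta>. \<forall>v\<in>strand F 0 \<beta>. \<beta> \<notin> U \<longrightarrow> strand_aug G (\<phi> 0 v) = strand_aug F v)"
proof -
  have fin: "finite (basis F i)" for i using F unfolding strandwise_exact_def by blast
  have "\<forall>e\<in>basis F 0. \<exists>w. w \<in> strand G 0 (mdeg F 0 e) \<and>
     (mdeg F 0 e \<notin> U \<longrightarrow> strand_aug G w = strand_aug F (unit_vec e))"
  proof
    fix e assume e: "e \<in> basis F 0"
    show "\<exists>w. w \<in> strand G 0 (mdeg F 0 e) \<and>
     (mdeg F 0 e \<notin> U \<longrightarrow> strand_aug G w = strand_aug F (unit_vec e))"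
    proof (cases "mdeg F 0 e \<in> U")
      case True
      then show ?thesis using fv.subspace_0[OF subspace_strand] by blast
    next
      case False
      then obtain v where v: "v \<in> strand G 0 (mdeg F 0 e)" "strand_aug G v = 1"
        using G unfolding strandwise_exact_def by blast
      have "strand_aug G (\<lambda>x. strand_aug F (unit_vec e) * v x) = strand_aug F (unit_vec e)"
        by (simp add: strand_aug_scale v(2))
      then show ?thesis
        using fv.subspace_scale[OF subspace_strand v(1)] by blast
    qed
  qed
  then obtain w where w: "\<And>e. e \<in> basis F 0 \<Longrightarrow> w e \<in> strand G 0 (mdeg F 0 e) \<and>
     (mdeg F 0 e \<notin> U \<longrightarrow> strand_aug G (w e) = strand_aug F (unit_vec e))"
    unfolding bchoice_iff by blast
  define \<phi>0 where "\<phi>0 v = (\<Sum>e\<in>basis F 0. (\<lambda>x. v e * w e x))" for v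
  have \<phi>0: "graded_map F 0 G 0 \<phi>0"
    unfolding \<phi>0_def using w by (intro graded_map_extend) blast
  have aug\<phi>0: "strand_aug G (\<phi>0 v) = strand_aug F v" if "\<beta> \<notin> U" "v \<in> strand F 0 \<beta>" for \<beta> v
  proof -
    have "strand_aug G (\<phi>0 v) = (\<Sum>e\<in>basis F 0. v e * strand_aug G (w e))"
      by (simp add: \<phi>0_def strand_aug_sum strand_aug_scale)
    also have "\<dots> = (\<Sum>e\<in>basis F 0. v e * strand_aug F (unit_vec e))"
    proof (intro sum.cong refl)
      fix e assume e: "e \<in> basis F 0"
      show "v e * strand_aug G (w e) = v e * strand_aug F (unit_vec e)"
      proof (cases "v e = 0")
        case False
        \<comment> \<open>The multidegree of e divides \<beta>, and a degree dividing one outside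
          the upward closed set U is outside U.\<close>
        then have "mdeg F 0 e \<notin> U" using that U unfolding strand_iff by blast
        then show ?thesis using w[OF e] by simp
      qed simp
    qed
    also have "\<dots> = strand_aug F (\<Sum>e\<in>basis F 0. (\<lambda>x. v e * unit_vec e x))"
      by (simp add: strand_aug_sum strand_aug_scale)
    also have "\<dots> = strand_aug F v"
      using strand_expand[OF fin that(2)] by (rule arg_cong[symmetric])
    finally show ?thesis .
  qed
  \<comment> \<open>The invariant records that cycles go to cycles, which is what the next lift
    needs, and fixes the map in degree 0 so that its compatibility with the augmentation survives
    the choice.\<close>
  let ?P = "\<lambda>i \<phi>. graded_map F i G i \<phi> \<and>
     (\<forall>\<beta>. \<forall>v\<in>strand_cycles F U i \<beta>. \<phi> v \<in> strand_cycles G U i \<beta>) \<and> (i = 0 \<longrightarrow> \<phi> = \<phi>0)"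
  let ?Q = "\<lambda>i \<phi> \<phi>'. \<forall>\<beta>. \<forall>v\<in>strand F (Suc i) \<beta>. strand_bd G i (\<phi>' v) = \<phi> (strand_bd F i v)"
  have base: "\<exists>\<phi>. ?P 0 \<phi>"
    using \<phi>0 aug\<phi>0 graded_mapD(2)[OF \<phi>0]
    by (intro exI[of _ \<phi>0]) (auto simp: strand_cycles_def)
  have step: "\<exists>\<phi>'. ?P (Suc i) \<phi>' \<and> ?Q i \<phi> \<phi>'" if "?P i \<phi>" for i \<phi>
  proof -
    have "graded_map F (Suc i) G i (\<lambda>v. \<phi> (strand_bd F i v))"
      using that graded_map_comp graded_map_strand_bd by blast
    moreover have "\<phi> (strand_bd F i v) \<in> strand_cycles G U i \<beta>"
      if "v \<in> strand F (Suc i) \<beta>" for v \<beta>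
      using \<open>?P i \<phi>\<close> strand_bd_in_cycles[OF F that] by blast
    ultimately have "\<exists>\<phi>'. graded_map F (Suc i) G (Suc i) \<phi>' \<and> ?Q i \<phi> \<phi>'"
      by (rule graded_map_lift[OF G fin])
    then obtain \<phi>' where \<phi>': "graded_map F (Suc i) G (Suc i) \<phi>'" "?Q i \<phi> \<phi>'"
      by blast
    have "\<phi>' v \<in> strand_cycles G U (Suc i) \<beta>" if "v \<in> strand_cycles F U (Suc i) \<beta>" for v \<beta>
    proof -
      have v: "v \<in> strand F (Suc i) \<beta>" "strand_bd F i v = 0"
        using that by (auto simp: strand_cycles_def)
      have "strand_bd G i (\<phi>' v) = \<phi> 0" using \<phi>'(2) v by metis
      also have "\<dots> = 0" using \<open>?P i \<phi>\<close> fp.linear_0 graded_mapD(1) by blast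
      finally show ?thesis
        using graded_mapD(2)[OF \<phi>'(1) v(1)] by (simp add: strand_cycles_def)
    qed
    with \<phi>' show ?thesis by blast
  qed
  have "\<exists>\<phi>. \<forall>i. ?P i (\<phi> i) \<and> ?Q i (\<phi> i) (\<phi> (Suc i))"
    by (rule dependent_nat_choice[OF base step])
  then obtain \<phi> where choice: "\<forall>i. ?P i (\<phi> i) \<and> ?Q i (\<phi> i) (\<phi> (Suc i))" ..
  have \<phi>: "?P i (\<phi> i)" "?Q i (\<phi> i) (\<phi> (Suc i))" for i
    by (rule conjunct1[OF spec[OF choice]], rule conjunct2[OF spec[OF choice]])
  show ?thesis
    using \<phi> aug\<phi>0 by (intro exI[of _ \<phi>]) metis
qed

text \<open>Each \<open>s (Suc i)\<close> is a lift of \<open>f (Suc i)\<close> minus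
  \<open>s i\<close> after the differential. In degree 0 the map \<open>f 0\<close> itself is
  lifted, since \<open>zero\<close> makes its values cycles.\<close>

lemma null_homotopy:
  fixes F :: "('n, 'k::field) graded_complex"
  assumes F: "strandwise_exact F U" and f: "\<And>i. graded_map F i F i (f i)"
    and comm: "\<And>i \<beta> v. v \<in> strand F (Suc i) \<beta> \<Longrightarrow> strand_bd F i (f (Suc i) v) = f i (strand_bd F i v)"
    and zero: "\<And>\<beta> v. \<beta> \<notin> U \<Longrightarrow> v \<in> strand F 0 \<beta> \<Longrightarrow> strand_aug F (f 0 v) = 0"
  shows "\<exists>s. (\<forall>i. graded_map F i F (Suc i) (s i)) \<and>
    (\<forall>\<beta>. \<forall>v\<in>strand F 0 \<beta>. f 0 v = strand_bd F 0 (s 0 v)) \<and>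
    (\<forall>i \<beta>. \<forall>v\<in>strand F (Suc i) \<beta>.
       f (Suc i) v = strand_bd F (Suc i) (s (Suc i) v) + s i (strand_bd F i v))"
proof -
  have fin: "finite (basis F i)" for i using F unfolding strandwise_exact_def by blast
  \<comment> \<open>On cycles the homotopy identity reduces to
    \<open>strand_bd F i (s v) = f i v\<close>. Applied to boundaries, this shows that the map to be
    lifted next takes values in cycles.\<close>
  let ?P = "\<lambda>i s. graded_map F i F (Suc i) s \<and>
     (\<forall>\<beta>. \<forall>v\<in>strand_cycles F U i \<beta>. strand_bd F i (s v) = f i v) \<and>
     (i = 0 \<longrightarrow> (\<forall>\<beta>. \<forall>v\<in>strand F 0 \<beta>. strand_bd F 0 (s v) = f 0 v))"
  let ?Q = "\<lambda>i s s'. \<forall>\<beta>. \<forall>v\<in>strand F (Suc i) \<beta>.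
     strand_bd F (Suc i) (s' v) = f (Suc i) v - s (strand_bd F i v)"
  have "f 0 v \<in> strand_cycles F U 0 \<beta>" if "v \<in> strand F 0 \<beta>" for v \<beta>
    using that zero graded_mapD(2)[OF f] by (auto simp: strand_cycles_def)
  from graded_map_lift[OF F fin f this] have base: "\<exists>s. ?P 0 s"
    using strand_cycles_subset by blast
  have step: "\<exists>s'. ?P (Suc i) s' \<and> ?Q i s s'" if s: "?P i s" for i s
  proof -
    let ?h = "\<lambda>v. f (Suc i) v - s (strand_bd F i v)"
    have h: "graded_map F (Suc i) F (Suc i) ?h"
      by (rule graded_map_diff[OF f graded_map_comp[OF conjunct1[OF s] graded_map_strand_bd]])
    have "?h v \<in> strand_cycles F U (Suc i) \<beta>" if v: "v \<in> strand F (Suc i) \<beta>" for v \<beta>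
    proof -
      have "strand_bd F i (s (strand_bd F i v)) = f i (strand_bd F i v)"
        using s strand_bd_in_cycles[OF F v] by blast
      then have "strand_bd F i (?h v) = 0"
        by (simp add: fp.linear_diff[OF lin_strand_bd] comm[OF v])
      then show ?thesis
        using graded_mapD(2)[OF h v] by (simp add: strand_cycles_def)
    qed
    then have "\<exists>s'. graded_map F (Suc i) F (Suc (Suc i)) s' \<and> ?Q i s s'"
      by (rule graded_map_lift[OF F fin h])
    then obtain s' where s': "graded_map F (Suc i) F (Suc (Suc i)) s'" "?Q i s s'"
      by blast
    have "strand_bd F (Suc i) (s' v) = f (Suc i) v" if "v \<in> strand_cycles F U (Suc i) \<beta>" for v \<beta>
    proof -
      have v: "v \<in> strand F (Suc i) \<beta>" "strand_bd F i v = 0"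
        using that by (auto simp: strand_cycles_def)
      have "s 0 = 0" using s fp.linear_0 graded_mapD(1) by blast
      then show ?thesis using s'(2) v by (metis diff_zero)
    qed
    with s' show ?thesis by blast
  qed
  have "\<exists>s. \<forall>i. ?P i (s i) \<and> ?Q i (s i) (s (Suc i))"
    by (rule dependent_nat_choice[OF base step])
  then obtain s where choice: "\<forall>i. ?P i (s i) \<and> ?Q i (s i) (s (Suc i))" ..
  have s: "?P i (s i)" "?Q i (s i) (s (Suc i))" for i
    by (rule conjunct1[OF spec[OF choice]], rule conjunct2[OF spec[OF choice]])
  show ?thesis
  proof (intro exI[of _ s] conjI allI ballI)
    show "graded_map F i F (Suc i) (s i)" for i using s(1) by blast
    show "f 0 v = strand_bd F 0 (s 0 v)" if "v \<in> strand F 0 \<beta>" for \<beta> v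
      using s(1)[of 0] that by metis
    show "f (Suc i) v = strand_bd F (Suc i) (s (Suc i) v) + s i (strand_bd F i v)"
      if "v \<in> strand F (Suc i) \<beta>" for i \<beta> v
      using s(2)[of i] that by (metis diff_add_cancel)
  qed
qed

subsection \<open>Independence of Tor from the resolution\<close>

text \<open>This is dim V/W \<le> dim V'/W' for a map that sends no class outside W to zero, written
  additively. Extend a basis of W to one of V; the images of the added vectors are independent
  modulo W'.\<close>

lemma (in vector_space) dim_quotient_le:
  assumes T: "Vector_Spaces.linear scale scale T"
    and W: "subspace W" "W \<subseteq> V" and V: "V \<subseteq> span X" "finite X" "subspace V"
    and W': "subspace W'" "W' \<subseteq> V'" and V': "V' \<subseteq> span X'" "finite X'"
    and map: "\<And>v. v \<in> V \<Longrightarrow> T v \<in> V'" and inj: "\<And>v. v \<in> V \<Longrightarrow> T v \<in> W' \<Longrightarrow> v \<in> W"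
  shows "dim V + dim W' \<le> dim V' + dim W"
proof -
  interpret p: vector_space_pair scale scale by unfold_locales
  obtain B where B: "B \<subseteq> W" "independent B" "W \<subseteq> span B" "card B = dim W"
    using basis_exists by blast
  have "B \<subseteq> V" using B(1) W(2) by (rule subset_trans)
  then obtain C where C: "B \<subseteq> C" "C \<subseteq> V" "independent C" "V \<subseteq> span C"
    using maximal_independent_subset_extend[OF _ B(2)] by metis
  have finC: "finite C"
    using independent_span_bound[OF V(2) C(3)] C(2) V(1) by (meson subset_trans)
  have finB: "finite B" using C(1) finC finite_subset by blast
  have cardC: "card C = dim V" using C by (intro basis_card_eq_dim)
  have "dim W' + card (C - B) \<le> dim V'"
  proof (rule dim_relative_le[OF W' V', where x = T])
    show "finite (C - B)" using finC by simp
    show "T ` (C - B) \<subseteq> V'" using map C(2) by blast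
    fix a assume a: "(\<Sum>c\<in>C - B. a c *s T c) \<in> W'"
    let ?z = "\<Sum>c\<in>C - B. a c *s c"
    have "?z \<in> V" using C(2) V(3) by (intro subspace_sum subspace_scale) blast+
    moreover have "T ?z = (\<Sum>c\<in>C - B. a c *s T c)"
      by (simp only: p.linear_sum[OF T] p.linear_scale[OF T])
    ultimately have "?z \<in> W" using inj a by metis
    then have "?z \<in> span B" using B(3) by (rule rev_subsetD)
    then obtain f where f: "?z = (\<Sum>b\<in>B. f b *s b)"
      using finB by (auto simp: span_finite)
    \<comment> \<open>Moves the expansion of the combination in the basis B of W to the other side,
      giving a linear relation on all of C.\<close>
    define g where "g c = (if c \<in> B then - f c else a c)" for c
    have "(\<Sum>c\<in>C. g c *s c) = (\<Sum>c\<in>C - B. g c *s c) + (\<Sum>c\<in>B. g c *s c)"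
      by (rule sum.subset_diff[OF C(1) finC])
    also have "(\<Sum>c\<in>C - B. g c *s c) = ?z" by (intro sum.cong) (auto simp: g_def)
    also have "(\<Sum>c\<in>B. g c *s c) = - (\<Sum>b\<in>B. f b *s b)"
      by (simp add: g_def sum_negf)
    finally have "(\<Sum>c\<in>C. g c *s c) = 0" using f by simp
    then have "\<forall>c\<in>C. g c = 0" using independentD[OF C(3) finC] by blast
    then show "\<forall>c\<in>C - B. a c = 0" by (auto simp: g_def)
  qed
  moreover have "card (C - B) = card C - card B" "card B \<le> card C"
    using finB finC C(1) by (simp_all add: card_Diff_subset card_mono)
  ultimately show ?thesis using cardC B(4) by linarith
qed

text \<open>Reduction modulo the variables in degree \<alpha>: basis elements whose multidegree
  properly divides \<alpha> contribute multiples of variables and become zero in F \<otimes>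
  K.\<close>

definition tor_proj :: "('n, 'k::field) graded_complex \<Rightarrow> nat \<Rightarrow> 'n mon \<Rightarrow> (nat \<Rightarrow> 'k) \<Rightarrow> (nat \<Rightarrow> 'k)" where
  "tor_proj F i \<alpha> v = (\<lambda>e. if e \<in> basis_at F i \<alpha> then v e else 0)"

lemma tor_chains_eq: "tor_chains F i \<alpha> = supported_on (basis_at F i \<alpha>)"
  by (simp add: tor_chains_def supported_on_def)

lemma tor_chains_strand: "v \<in> tor_chains F i \<alpha> \<Longrightarrow> v \<in> strand F i \<alpha>"
  by (simp add: strand_iff tor_chains_def basis_at_def) (metis mdvd_refl)

lemma tor_proj_chains: "tor_proj F i \<alpha> v \<in> tor_chains F i \<alpha>"
  by (simp add: tor_proj_def tor_chains_def)

lemma tor_proj_id: "v \<in> tor_chains F i \<alpha> \<Longrightarrow> tor_proj F i \<alpha> v = v"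
  by (auto simp: tor_proj_def tor_chains_def fun_eq_iff)

lemma lin_tor_proj: "lin (tor_proj F i \<alpha>)"
  by (intro linI; rule ext) (simp_all add: tor_proj_def)

lemma tor_proj_0: "tor_proj F i \<alpha> 0 = 0"
  by (rule fp.linear_0[OF lin_tor_proj])

text \<open>Graded maps descend to F \<otimes> K. A basis element whose multidegree properly divides
  \<alpha> is sent into the strand at that multidegree, where no basis element of multidegree
  \<alpha> occurs.\<close>

lemma tor_proj_graded_map:
  assumes L: "graded_map F i G j L" and fin: "finite (basis F i)" and v: "v \<in> strand F i \<alpha>"
  shows "tor_proj G j \<alpha> (L (tor_proj F i \<alpha> v)) = tor_proj G j \<alpha> (L v)"
proof -
  let ?u = "v - tor_proj F i \<alpha> v"
  have u: "?u \<in> strand F i \<alpha>"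
    by (intro fv.subspace_diff subspace_strand v tor_chains_strand tor_proj_chains)
  have "L ?u e = 0" if e: "e \<in> basis_at G j \<alpha>" for e
  proof -
    have "L ?u e = (\<Sum>b\<in>basis F i. ?u b * L (unit_vec b) e)"
      using fun_cong[OF lin_expand[OF graded_mapD(1)[OF L] fin u], of e]
      unfolding sum_fun_apply .
    also have "\<dots> = 0"
    proof (rule sum.neutral, rule ballI, rule ccontr)
      fix b assume b: "b \<in> basis F i" "?u b * L (unit_vec b) e \<noteq> 0"
      then have 1: "?u b \<noteq> 0" "L (unit_vec b) e \<noteq> 0" by auto
      then have "mdvd (mdeg F i b) \<alpha>" "mdeg F i b \<noteq> \<alpha>"
        using u b(1) by (auto simp: strand_iff tor_proj_def basis_at_def)
      moreover have "L (unit_vec b) \<in> strand G j (mdeg F i b)"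
        using graded_mapD(2)[OF L] unit_vec_strand[OF b(1)] by simp
      then have "mdvd \<alpha> (mdeg F i b)"
        using 1(2) e unfolding strand_iff basis_at_def by blast
      ultimately show False using mdvd_antisym by blast
    qed
    finally show ?thesis .
  qed
  moreover have "L ?u = L v - L (tor_proj F i \<alpha> v)"
    by (rule fp.linear_diff[OF graded_mapD(1)[OF L]])
  ultimately show ?thesis by (simp add: tor_proj_def fun_eq_iff)
qed

text \<open>Between basis elements of equal multidegree the exponent difference is 0, so
  \<open>coef\<close> is the constant term.\<close>

lemma tor_bd_eq:
  assumes fin: "finite (basis F (Suc i))" and v: "v \<in> tor_chains F (Suc i) \<alpha>"
  shows "tor_bd F i \<alpha> v = tor_proj F i \<alpha> (strand_bd F i v)"
proof
  fix a
  show "tor_bd F i \<alpha> v a = tor_proj F i \<alpha> (strand_bd F i v) a"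
  proof (cases "a \<in> basis_at F i \<alpha>")
    case True
    have "(\<Sum>b\<in>basis F (Suc i). coef F i a b * v b) = (\<Sum>b\<in>basis_at F (Suc i) \<alpha>. coef F i a b * v b)"
      using fin v by (intro sum.mono_neutral_right) (auto simp: basis_at_def tor_chains_def)
    also have "\<dots> = (\<Sum>b\<in>basis_at F (Suc i) \<alpha>. Poly_Mapping.lookup (bd F i a b) 0 * v b)"
      using True by (intro sum.cong) (auto simp: coef_def basis_at_def)
    finally show ?thesis
      using True by (simp add: tor_bd_def tor_proj_def strand_bd_def basis_at_def)
  qed (simp add: tor_bd_def tor_proj_def)
qed

lemma lin_tor_bd: "lin (tor_bd F i \<alpha>)"
proof (rule linI)
  fix u v :: "nat \<Rightarrow> 'a" and c :: 'a
  show "tor_bd F i \<alpha> (u + v) = tor_bd F i \<alpha> u + tor_bd F i \<alpha> v"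
    by (rule ext) (simp add: tor_bd_def distrib_left sum.distrib)
  show "tor_bd F i \<alpha> (\<lambda>e. c * v e) = (\<lambda>e. c * tor_bd F i \<alpha> v e)"
    by (rule ext) (simp add: tor_bd_def sum_distrib_left mult.left_commute)
qed

lemma tor_bd_chains: "tor_bd F i \<alpha> v \<in> tor_chains F i \<alpha>"
  by (simp add: tor_bd_def tor_chains_def)

lemma subspace_tor_chains: "fv.subspace (tor_chains F i \<alpha>)"
  by (simp add: tor_chains_eq subspace_supported_on)

lemma tor_cycles_subset: "tor_cycles F i \<alpha> \<subseteq> tor_chains F i \<alpha>"
  by (auto simp: tor_cycles_def)

lemma subspace_tor_cycles: "fv.subspace (tor_cycles F i \<alpha>)"
proof (cases i)
  case 0
  then show ?thesis using subspace_tor_chains by (simp add: tor_cycles_def)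
next
  case (Suc j)
  have "fv.subspace {v. tor_bd F j \<alpha> v = 0}"
    by (rule fp.linear_subspace_kernel[OF lin_tor_bd])
  then have "fv.subspace (tor_chains F i \<alpha> \<inter> {v. tor_bd F j \<alpha> v = 0})"
    using subspace_tor_chains by (rule fv.subspace_inter[rotated])
  then show ?thesis using Suc by (simp add: tor_cycles_def Int_def)
qed

lemma subspace_tor_boundaries: "fv.subspace (tor_boundaries F i \<alpha>)"
  unfolding tor_boundaries_def by (intro fp.linear_subspace_image lin_tor_bd subspace_tor_chains)

lemma finite_basis_at: "finite (basis F i) \<Longrightarrow> finite (basis_at F i \<alpha>)"
  by (simp add: basis_at_def)

lemma tor_boundaries_subset:
  assumes F: "strandwise_exact F U"
  shows "tor_boundaries F i \<alpha> \<subseteq> tor_cycles F i \<alpha>"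
proof
  have fin: "finite (basis F i)" for i using F unfolding strandwise_exact_def by blast
  fix v assume "v \<in> tor_boundaries F i \<alpha>"
  then obtain w where w: "w \<in> tor_chains F (Suc i) \<alpha>" "v = tor_bd F i \<alpha> w"
    unfolding tor_boundaries_def by blast
  have v: "v \<in> tor_chains F i \<alpha>" using w(2) tor_bd_chains by blast
  show "v \<in> tor_cycles F i \<alpha>"
  proof (cases i)
    case (Suc j)
    have ws: "w \<in> strand F (Suc i) \<alpha>" by (rule tor_chains_strand[OF w(1)])
    have "tor_bd F j \<alpha> v = tor_proj F j \<alpha> (strand_bd F j v)"
      using tor_bd_eq fin v Suc by blast
    also have "\<dots> = tor_proj F j \<alpha> (strand_bd F j (strand_bd F i w))"
      unfolding w(2) tor_bd_eq[OF fin w(1)] unfolding Suc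
      by (rule tor_proj_graded_map[OF graded_map_strand_bd fin
            graded_mapD(2)[OF graded_map_strand_bd ws[unfolded Suc]]])
    also have "strand_bd F j (strand_bd F i w) = 0"
      using strand_bd_in_cycles[OF F ws] Suc by (simp add: strand_cycles_def)
    finally have "tor_bd F j \<alpha> v = 0" by (simp only: tor_proj_0)
    then show ?thesis using v Suc by (simp add: tor_cycles_def)
  qed (use v in \<open>simp add: tor_cycles_def\<close>)
qed

text \<open>With comparison maps \<phi> and \<psi> in both directions, \<psi> after \<phi> is
  homotopic to the identity, so \<phi> is injective on Tor. Exchanging F and G gives the reverse
  inequality, so surjectivity is not treated separately.\<close>

lemma tor_dim_le:
  fixes F G :: "('n, 'k::field) graded_complex"
  assumes F: "strandwise_exact F U" and G: "strandwise_exact G U"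
    and U: "\<And>s t. s \<in> U \<Longrightarrow> mdvd s t \<Longrightarrow> t \<in> U"
  shows "tor_dim F i \<alpha> \<le> tor_dim G i \<alpha>"
proof -
  have finF: "finite (basis F i)" for i using F unfolding strandwise_exact_def by blast
  have finG: "finite (basis G i)" for i using G unfolding strandwise_exact_def by blast
  from comparison_map[OF F G U] obtain \<phi> where
      "(\<forall>i. graded_map F i G i (\<phi> i)) \<and>
      (\<forall>i \<beta>. \<forall>v\<in>strand F (Suc i) \<beta>. strand_bd G i (\<phi> (Suc i) v) = \<phi> i (strand_bd F i v)) \<and>
      (\<forall>\<beta>. \<forall>v\<in>strand F 0 \<beta>. \<beta> \<notin> U \<longrightarrow> strand_aug G (\<phi> 0 v) = strand_aug F v)" ..
  then have \<phi>: "\<And>i. graded_map F i G i (\<phi> i)"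
    and \<phi>_bd: "\<And>i \<beta> v. v \<in> strand F (Suc i) \<beta> \<Longrightarrow> strand_bd G i (\<phi> (Suc i) v) = \<phi> i (strand_bd F i v)"
    and \<phi>_aug: "\<And>\<beta> v. \<beta> \<notin> U \<Longrightarrow> v \<in> strand F 0 \<beta> \<Longrightarrow> strand_aug G (\<phi> 0 v) = strand_aug F v"
    by blast+
  from comparison_map[OF G F U] obtain \<psi> where
      "(\<forall>i. graded_map G i F i (\<psi> i)) \<and>
      (\<forall>i \<beta>. \<forall>v\<in>strand G (Suc i) \<beta>. strand_bd F i (\<psi> (Suc i) v) = \<psi> i (strand_bd G i v)) \<and>
      (\<forall>\<beta>. \<forall>v\<in>strand G 0 \<beta>. \<beta> \<notin> U \<longrightarrow> strand_aug F (\<psi> 0 v) = strand_aug G v)" ..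
  then have \<psi>: "\<And>i. graded_map G i F i (\<psi> i)"
    and \<psi>_bd: "\<And>i \<beta> v. v \<in> strand G (Suc i) \<beta> \<Longrightarrow> strand_bd F i (\<psi> (Suc i) v) = \<psi> i (strand_bd G i v)"
    and \<psi>_aug: "\<And>\<beta> v. \<beta> \<notin> U \<Longrightarrow> v \<in> strand G 0 \<beta> \<Longrightarrow> strand_aug F (\<psi> 0 v) = strand_aug G v"
    by blast+
  \<comment> \<open>The difference between the identity and the round trip; it commutes with the
    differentials and is killed by the augmentation outside U, so it is null-homotopic.\<close>
  define f where "f i v = v - \<psi> i (\<phi> i v)" for i v
  have f: "graded_map F i F i (f i)" for i
    unfolding f_def by (intro graded_map_diff graded_map_id graded_map_comp[OF \<psi> \<phi>])
  have f_bd: "strand_bd F i (f (Suc i) v) = f i (strand_bd F i v)" if "v \<in> strand F (Suc i) \<beta>" for i \<beta> v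
    unfolding f_def fp.linear_diff[OF lin_strand_bd]
    using \<psi>_bd[OF graded_mapD(2)[OF \<phi> that]] \<phi>_bd[OF that] by simp
  have f_aug: "strand_aug F (f 0 v) = 0" if "\<beta> \<notin> U" "v \<in> strand F 0 \<beta>" for \<beta> v
    unfolding f_def strand_aug_diff
    using \<psi>_aug[OF that(1) graded_mapD(2)[OF \<phi> that(2)]] \<phi>_aug[OF that] by simp
  from null_homotopy[OF F f f_bd f_aug] obtain s where
    "(\<forall>i. graded_map F i F (Suc i) (s i)) \<and>
    (\<forall>\<beta>. \<forall>v\<in>strand F 0 \<beta>. f 0 v = strand_bd F 0 (s 0 v)) \<and>
    (\<forall>i \<beta>. \<forall>v\<in>strand F (Suc i) \<beta>.
       f (Suc i) v = strand_bd F (Suc i) (s (Suc i) v) + s i (strand_bd F i v))" ..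
  then have s: "\<And>i. graded_map F i F (Suc i) (s i)"
    and s_0: "\<And>\<beta> v. v \<in> strand F 0 \<beta> \<Longrightarrow> f 0 v = strand_bd F 0 (s 0 v)"
    and s_Suc: "\<And>i \<beta> v. v \<in> strand F (Suc i) \<beta> \<Longrightarrow>
       f (Suc i) v = strand_bd F (Suc i) (s (Suc i) v) + s i (strand_bd F i v)"
    by blast+
  let ?T = "\<lambda>v. tor_proj G i \<alpha> (\<phi> i v)"
  have cycles: "?T z \<in> tor_cycles G i \<alpha>" if z: "z \<in> tor_cycles F i \<alpha>" for z
  proof (cases i)
    case (Suc j)
    have zc: "z \<in> tor_chains F (Suc j) \<alpha>" using z tor_cycles_subset Suc by blast
    note zs = tor_chains_strand[OF zc]
    have "tor_bd G j \<alpha> (?T z) = tor_proj G j \<alpha> (strand_bd G j (tor_proj G (Suc j) \<alpha> (\<phi> (Suc j) z)))"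
      unfolding Suc by (rule tor_bd_eq[OF finG tor_proj_chains])
    also have "\<dots> = tor_proj G j \<alpha> (strand_bd G j (\<phi> (Suc j) z))"
      by (rule tor_proj_graded_map[OF graded_map_strand_bd finG graded_mapD(2)[OF \<phi> zs]])
    also have "\<dots> = tor_proj G j \<alpha> (\<phi> j (strand_bd F j z))"
      by (simp only: \<phi>_bd[OF zs])
    also have "\<dots> = tor_proj G j \<alpha> (\<phi> j (tor_proj F j \<alpha> (strand_bd F j z)))"
      by (rule tor_proj_graded_map[OF \<phi> finF graded_mapD(2)[OF graded_map_strand_bd zs], symmetric])
    also have "tor_proj F j \<alpha> (strand_bd F j z) = 0"
      using z Suc tor_bd_eq[OF finF zc] by (simp add: tor_cycles_def)
    finally have "tor_bd G j \<alpha> (?T z) = 0"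
      by (simp only: fp.linear_0[OF graded_mapD(1)[OF \<phi>]] tor_proj_0)
    then show ?thesis using Suc tor_proj_chains[of G i \<alpha>] by (simp add: tor_cycles_def)
  next
    case 0
    then show ?thesis using tor_proj_chains[of G i \<alpha>] by (simp add: tor_cycles_def)
  qed
  have reflect: "z \<in> tor_boundaries F i \<alpha>"
    if z: "z \<in> tor_cycles F i \<alpha>" and Tz: "?T z \<in> tor_boundaries G i \<alpha>" for z
  proof -
    have zc: "z \<in> tor_chains F i \<alpha>" using z tor_cycles_subset by blast
    note zs = tor_chains_strand[OF zc]
    obtain w where w: "w \<in> tor_chains G (Suc i) \<alpha>" "?T z = tor_bd G i \<alpha> w"
      using Tz unfolding tor_boundaries_def by blast
    note ws = tor_chains_strand[OF w(1)]
    have "tor_proj F i \<alpha> (\<psi> i (\<phi> i z)) = tor_proj F i \<alpha> (\<psi> i (?T z))"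
      by (rule tor_proj_graded_map[OF \<psi> finG graded_mapD(2)[OF \<phi> zs], symmetric])
    also have "\<dots> = tor_proj F i \<alpha> (\<psi> i (strand_bd G i w))"
      unfolding w(2) tor_bd_eq[OF finG w(1)]
      by (rule tor_proj_graded_map[OF \<psi> finG graded_mapD(2)[OF graded_map_strand_bd ws]])
    also have "\<dots> = tor_proj F i \<alpha> (strand_bd F i (\<psi> (Suc i) w))"
      by (simp only: \<psi>_bd[OF ws])
    finally have 1: "tor_proj F i \<alpha> (\<psi> i (\<phi> i z)) = tor_proj F i \<alpha> (strand_bd F i (\<psi> (Suc i) w))" .
    have 2: "tor_proj F i \<alpha> (f i z) = tor_proj F i \<alpha> (strand_bd F i (s i z))"
    proof (cases i)
      case 0
      then show ?thesis using s_0 zs by metis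
    next
      case (Suc j)
      have zs': "z \<in> strand F (Suc j) \<alpha>" using zs Suc by simp
      have "tor_proj F j \<alpha> (strand_bd F j z) = 0"
        using z zc[unfolded Suc] tor_bd_eq[OF finF zc[unfolded Suc]] Suc by (simp add: tor_cycles_def)
      \<comment> \<open>The cycle z satisfies \<open>strand_bd F j z = 0\<close> only after
        reduction, so this term of the homotopy vanishes only after reduction as well.\<close>
      then have "tor_proj F i \<alpha> (s j (strand_bd F j z)) = tor_proj F i \<alpha> (s j 0)"
        unfolding Suc
        using tor_proj_graded_map[OF s finF graded_mapD(2)[OF graded_map_strand_bd zs']] by metis
      also have "\<dots> = 0" by (simp only: fp.linear_0[OF graded_mapD(1)[OF s]] tor_proj_0)
      finally show ?thesis
        unfolding Suc s_Suc[OF zs'] fp.linear_add[OF lin_tor_proj] by simp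
    qed
    \<comment> \<open>The first summand bounds \<open>f i z\<close>, the second bounds the round
      trip of z, both modulo the variables; their sum therefore bounds z in F \<otimes> K.\<close>
    let ?y = "s i z + \<psi> (Suc i) w"
    have y: "?y \<in> strand F (Suc i) \<alpha>"
      by (intro fv.subspace_add subspace_strand graded_mapD(2)[OF s zs] graded_mapD(2)[OF \<psi> ws])
    have "z = tor_proj F i \<alpha> (f i z + \<psi> i (\<phi> i z))"
      by (simp add: f_def tor_proj_id[OF zc])
    also have "\<dots> = tor_proj F i \<alpha> (strand_bd F i ?y)"
      unfolding fp.linear_add[OF lin_tor_proj] fp.linear_add[OF lin_strand_bd] 1 2 ..
    also have "\<dots> = tor_proj F i \<alpha> (strand_bd F i (tor_proj F (Suc i) \<alpha> ?y))"
      by (rule tor_proj_graded_map[OF graded_map_strand_bd finF y, symmetric])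
    also have "\<dots> = tor_bd F i \<alpha> (tor_proj F (Suc i) \<alpha> ?y)"
      by (rule tor_bd_eq[OF finF tor_proj_chains, symmetric])
    finally show ?thesis
      unfolding tor_boundaries_def using tor_proj_chains by blast
  qed
  have spanF: "tor_cycles F i \<alpha> \<subseteq> fv.span (unit_vec ` basis_at F i \<alpha>)"
    using tor_cycles_subset supported_on_span[OF finite_basis_at[OF finF]]
    unfolding tor_chains_eq by (rule subset_trans)
  have spanG: "tor_cycles G i \<alpha> \<subseteq> fv.span (unit_vec ` basis_at G i \<alpha>)"
    using tor_cycles_subset supported_on_span[OF finite_basis_at[OF finG]]
    unfolding tor_chains_eq by (rule subset_trans)
  have "fv.dim (tor_cycles F i \<alpha>) + fv.dim (tor_boundaries G i \<alpha>)
      \<le> fv.dim (tor_cycles G i \<alpha>) + fv.dim (tor_boundaries F i \<alpha>)"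
    using lin_comp[OF lin_tor_proj graded_mapD(1)[OF \<phi>]]
      subspace_tor_boundaries tor_boundaries_subset[OF F]
      spanF finite_imageI[OF finite_basis_at[OF finF]] subspace_tor_cycles
      subspace_tor_boundaries tor_boundaries_subset[OF G]
      spanG finite_imageI[OF finite_basis_at[OF finG]] cycles reflect
    by (rule fv.dim_quotient_le)
  then show ?thesis unfolding tor_dim_def by linarith
qed

subsection \<open>Resolutions of monomial ideals and their strands\<close>

lemma lookup_single_times:
  fixes q :: "('n, 'k::field) mpol"
  shows "Poly_Mapping.lookup (Poly_Mapping.single s c * q) u =
    (if mdvd s u then c * Poly_Mapping.lookup q (u - s) else 0)"
proof -
  have "Poly_Mapping.lookup (Poly_Mapping.single s c * q) u =
      c * Sum_any (\<lambda>t. Poly_Mapping.lookup q t when u = s + t)"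
    by (simp add: lookup_mult lookup_single when_mult)
  also have "\<dots> = (if mdvd s u then c * Poly_Mapping.lookup q (u - s) else 0)"
  proof (cases "mdvd s u")
    case True
    then obtain r where r: "u = s + r" unfolding mdvd_def by blast
    then have "(u = s + t) = (t = r)" for t by auto
    then show ?thesis using True r by simp
  next
    case False
    then have "(u = s + t) = False" for t unfolding mdvd_def by blast
    then show ?thesis using False by simp
  qed
  finally show ?thesis .
qed

lemma mpol_eq_sum_single:
  fixes p :: "('n, 'k::field) mpol"
  shows "p = (\<Sum>t\<in>Poly_Mapping.keys p. Poly_Mapping.single t (Poly_Mapping.lookup p t))"
proof (rule poly_mapping_eqI)
  fix u
  have "(\<Sum>t\<in>Poly_Mapping.keys p. Poly_Mapping.lookup (Poly_Mapping.single t (Poly_Mapping.lookup p t)) u)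
      = (\<Sum>t\<in>Poly_Mapping.keys p. if t = u then Poly_Mapping.lookup p t else 0)"
    by (intro sum.cong refl) (simp add: lookup_single)
  also have "\<dots> = Poly_Mapping.lookup p u"
    by (simp add: in_keys_iff)
  finally show "Poly_Mapping.lookup p u = Poly_Mapping.lookup
      (\<Sum>t\<in>Poly_Mapping.keys p. Poly_Mapping.single t (Poly_Mapping.lookup p t)) u"
    by (simp add: lookup_sum)
qed

definition ideal_degrees :: "'n mon set \<Rightarrow> 'n mon set" where
  "ideal_degrees M = {t. \<exists>m\<in>M. mdvd m t}"

lemma ideal_degrees_up: "s \<in> ideal_degrees M \<Longrightarrow> mdvd s t \<Longrightarrow> t \<in> ideal_degrees M"
  unfolding ideal_degrees_def using mdvd_trans by blast

lemma module_mpol: "module ((*) :: ('n, 'k::field) mpol \<Rightarrow> _)"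
  by unfold_locales (simp_all add: algebra_simps)

text \<open>Ties a monomial ideal to the set U of degrees used for strands: the polynomials with
  exponents in \<open>ideal_degrees M\<close> form an ideal containing the generators, and
  conversely each term of such a polynomial is a multiple of a generator.\<close>

lemma monomial_ideal_iff:
  fixes p :: "('n, 'k::field) mpol"
  shows "p \<in> monomial_ideal M \<longleftrightarrow> Poly_Mapping.keys p \<subseteq> ideal_degrees M"
proof
  let ?S = "{p :: ('n, 'k) mpol. Poly_Mapping.keys p \<subseteq> ideal_degrees M}"
  have "module.subspace (*) ?S"
  proof (rule module.subspaceI[OF module_mpol])
    fix p q :: "('n, 'k) mpol" and c
    assume p: "p \<in> ?S"
    show "p + q \<in> ?S" if "q \<in> ?S"
      using that p keys_add[of p q] by blast
    have "Poly_Mapping.keys (c * p) \<subseteq> ideal_degrees M"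
    proof
      fix t assume "t \<in> Poly_Mapping.keys (c * p)"
      then obtain a b where "t = a + b" "b \<in> Poly_Mapping.keys p"
        using keys_mult[of c p] by blast
      then show "t \<in> ideal_degrees M"
        using p ideal_degrees_up[of b M t] unfolding mdvd_def by (auto simp: add.commute)
    qed
    then show "c * p \<in> ?S" by simp
  qed simp
  moreover have "(\<lambda>t. Poly_Mapping.single t 1) ` M \<subseteq> ?S"
    unfolding ideal_degrees_def using mdvd_refl by fastforce
  ultimately show "p \<in> monomial_ideal M \<Longrightarrow> Poly_Mapping.keys p \<subseteq> ideal_degrees M"
    unfolding monomial_ideal_def using module.span_minimal[OF module_mpol] by blast
next
  assume p: "Poly_Mapping.keys p \<subseteq> ideal_degrees M"
  have "(\<Sum>t\<in>Poly_Mapping.keys p. Poly_Mapping.single t (Poly_Mapping.lookup p t)) \<in> monomial_ideal M"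
    unfolding monomial_ideal_def
  proof (rule module.span_sum[OF module_mpol])
    fix t assume "t \<in> Poly_Mapping.keys p"
    then obtain m r where m: "m \<in> M" "t = m + r"
      using p unfolding ideal_degrees_def mdvd_def by blast
    have "Poly_Mapping.single t (Poly_Mapping.lookup p t) =
        Poly_Mapping.single r (Poly_Mapping.lookup p t) * Poly_Mapping.single m 1"
      by (simp add: mult_single m(2) add.commute)
    also have "\<dots> \<in> module.span (*) ((\<lambda>t. Poly_Mapping.single t 1) ` M)"
      by (intro module.span_scale[OF module_mpol] module.span_base[OF module_mpol] imageI m(1))
    finally show "Poly_Mapping.single t (Poly_Mapping.lookup p t) \<in>
        module.span (*) ((\<lambda>t. Poly_Mapping.single t 1) ` M)" .
  qed
  then show "p \<in> monomial_ideal M" using mpol_eq_sum_single[of p] by simp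
qed

section \<open>Polynomial vectors and their homogeneous components\<close>

definition homogeneous_maps :: "('n, 'k::field) graded_complex \<Rightarrow> bool" where
  "homogeneous_maps F \<longleftrightarrow> (\<forall>i. finite (basis F i)) \<and>
     (\<forall>i. \<forall>a\<in>basis F i. \<forall>b\<in>basis F (Suc i). \<forall>t\<in>Poly_Mapping.keys (bd F i a b).
        mdeg F i a + t = mdeg F (Suc i) b) \<and>
     (\<forall>e\<in>basis F 0. Poly_Mapping.keys (aug F e) \<subseteq> {mdeg F 0 e})"

lemma homogeneous_maps_bd:
  "homogeneous_maps F \<Longrightarrow> a \<in> basis F i \<Longrightarrow> b \<in> basis F (Suc i) \<Longrightarrow>
    t \<in> Poly_Mapping.keys (bd F i a b) \<Longrightarrow> mdeg F i a + t = mdeg F (Suc i) b"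
  by (simp add: homogeneous_maps_def)

text \<open>Strand coordinates of the degree \<beta> part of a polynomial vector. Entries outside
  the basis are set to 0, as polynomial vectors are arbitrary there. \<open>homogenize\<close> goes
  back from a strand vector to a vector concentrated in degree \<beta>.\<close>

definition component ::
    "('n, 'k::field) graded_complex \<Rightarrow> nat \<Rightarrow> 'n mon \<Rightarrow> (nat \<Rightarrow> ('n, 'k) mpol) \<Rightarrow> (nat \<Rightarrow> 'k)" where
  "component F i \<beta> p = (\<lambda>e. if e \<in> basis F i \<and> mdvd (mdeg F i e) \<beta>
     then Poly_Mapping.lookup (p e) (\<beta> - mdeg F i e) else 0)"

definition homogenize ::
    "('n, 'k::field) graded_complex \<Rightarrow> nat \<Rightarrow> 'n mon \<Rightarrow> (nat \<Rightarrow> 'k) \<Rightarrow> (nat \<Rightarrow> ('n, 'k) mpol)" where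
  "homogenize F i \<beta> v = (\<lambda>e. if mdvd (mdeg F i e) \<beta>
     then Poly_Mapping.single (\<beta> - mdeg F i e) (v e) else 0)"

lemma component_strand: "component F i \<beta> p \<in> strand F i \<beta>"
  by (simp add: strand_iff component_def)

lemma mdvd_diff: "mdvd s t \<Longrightarrow> s + (t - s) = t"
  unfolding mdvd_def by auto

lemma mdvd_diff_inject:
  assumes "mdvd s t" "mdvd s u" "t - s = u - s" shows "t = u"
  by (rule trans[OF mdvd_diff[OF assms(1), symmetric, unfolded assms(3)] mdvd_diff[OF assms(2)]])

lemma component_homogenize:
  assumes "v \<in> strand F i \<beta>"
  shows "component F i \<gamma> (homogenize F i \<beta> v) = (if \<gamma> = \<beta> then v else 0)"
proof
  fix e
  show "component F i \<gamma> (homogenize F i \<beta> v) e = (if \<gamma> = \<beta> then v else 0) e"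
  proof (cases "e \<in> basis F i \<and> mdvd (mdeg F i e) \<beta>")
    case True
    then show ?thesis
      using mdvd_diff_inject[of "mdeg F i e" \<beta> \<gamma>]
      by (auto simp: component_def homogenize_def lookup_single when_def)
  next
    case False
    then have "v e = 0" using assms unfolding strand_iff by blast
    then show ?thesis using False by (simp add: component_def homogenize_def)
  qed
qed

lemma component_eq_iff:
  "(\<forall>\<beta>. component F i \<beta> p = component F i \<beta> q) \<longleftrightarrow> (\<forall>e\<in>basis F i. p e = q e)"
proof
  assume eq: "\<forall>\<beta>. component F i \<beta> p = component F i \<beta> q"
  show "\<forall>e\<in>basis F i. p e = q e"
  proof (intro ballI poly_mapping_eqI)
    fix e t assume e: "e \<in> basis F i"
    have "component F i (mdeg F i e + t) p e = component F i (mdeg F i e + t) q e"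
      by (rule fun_cong[OF spec[OF eq]])
    then show "Poly_Mapping.lookup (p e) t = Poly_Mapping.lookup (q e) t"
      using e by (auto simp: component_def mdvd_def)
  qed
next
  assume "\<forall>e\<in>basis F i. p e = q e"
  then show "\<forall>\<beta>. component F i \<beta> p = component F i \<beta> q"
    unfolding component_def by (intro allI ext) auto
qed

lemma finite_components:
  assumes "finite (basis F i)"
  shows "finite {\<beta>. component F i \<beta> p \<noteq> 0}"
proof (rule finite_subset)
  show "finite (\<Union>e\<in>basis F i. (\<lambda>t. mdeg F i e + t) ` Poly_Mapping.keys (p e))"
    using assms by simp
  show "{\<beta>. component F i \<beta> p \<noteq> 0} \<subseteq>
      (\<Union>e\<in>basis F i. (\<lambda>t. mdeg F i e + t) ` Poly_Mapping.keys (p e))"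
  proof
    fix \<beta> assume "\<beta> \<in> {\<beta>. component F i \<beta> p \<noteq> 0}"
    then obtain e where "component F i \<beta> p e \<noteq> 0" unfolding fun_eq_iff by auto
    then have e: "e \<in> basis F i" "mdvd (mdeg F i e) \<beta>"
      "\<beta> - mdeg F i e \<in> Poly_Mapping.keys (p e)"
      by (auto simp: component_def in_keys_iff split: if_splits)
    moreover have "\<beta> = mdeg F i e + (\<beta> - mdeg F i e)" using mdvd_diff[OF e(2)] by simp
    ultimately show "\<beta> \<in> (\<Union>e\<in>basis F i. (\<lambda>t. mdeg F i e + t) ` Poly_Mapping.keys (p e))"
      by blast
  qed
qed

text \<open>Polynomials have finitely many terms, so only families with finitely many nonzero
  members come from a polynomial vector.\<close>

lemma assemble_components:
  assumes fin: "finite {\<beta>. w \<beta> \<noteq> 0}" and w: "\<And>\<beta>. w \<beta> \<in> strand F i \<beta>"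
  shows "\<exists>p. \<forall>\<beta>. component F i \<beta> p = w \<beta>"
proof (intro exI allI ext)
  let ?N = "{\<beta>. w \<beta> \<noteq> 0}"
  fix \<gamma> e
  let ?p = "\<lambda>e. \<Sum>\<beta>\<in>?N. homogenize F i \<beta> (w \<beta>) e"
  have "component F i \<gamma> ?p e = (\<Sum>\<beta>\<in>?N. component F i \<gamma> (homogenize F i \<beta> (w \<beta>)) e)"
    by (cases "e \<in> basis F i \<and> mdvd (mdeg F i e) \<gamma>") (auto simp: component_def lookup_sum)
  also have "\<dots> = (\<Sum>\<beta>\<in>?N. if \<gamma> = \<beta> then w \<beta> e else 0)"
    by (intro sum.cong refl) (simp add: component_homogenize[OF w])
  also have "\<dots> = w \<gamma> e" using fin by simp
  finally show "component F i \<gamma> ?p e = w \<gamma> e" .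
qed

text \<open>Homogeneity makes every entry a single term \<open>coef F i a b\<close> times a
  monomial, and multiplying by it shifts degrees by exactly the difference of the
  multidegrees.\<close>

lemma component_bd:
  assumes F: "homogeneous_maps F"
  shows "component F i \<beta> (\<lambda>a. \<Sum>b\<in>basis F (Suc i). bd F i a b * p b) =
    strand_bd F i (component F (Suc i) \<beta> p)"
proof
  fix a
  let ?d = "mdeg F i a"
  show "component F i \<beta> (\<lambda>a. \<Sum>b\<in>basis F (Suc i). bd F i a b * p b) a =
    strand_bd F i (component F (Suc i) \<beta> p) a"
  proof (cases "a \<in> basis F i")
    case a: True
    show ?thesis
    proof (cases "mdvd ?d \<beta>")
      case True
      have "Poly_Mapping.lookup (bd F i a b * p b) (\<beta> - ?d) =
          coef F i a b * component F (Suc i) \<beta> p b" if b: "b \<in> basis F (Suc i)" for b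
      proof (cases "mdvd ?d (mdeg F (Suc i) b)")
        case db: True
        let ?s = "mdeg F (Suc i) b - ?d"
        have "Poly_Mapping.keys (bd F i a b) \<subseteq> {?s}"
        proof
          fix t assume "t \<in> Poly_Mapping.keys (bd F i a b)"
          from homogeneous_maps_bd[OF F a b this] show "t \<in> {?s}" by (metis add_diff_cancel_left' singletonI)
        qed
        then have bd: "bd F i a b = Poly_Mapping.single ?s (coef F i a b)"
          using db by (intro poly_mapping_eqI) (auto simp: lookup_single when_def coef_def in_keys_iff)
        have iff: "mdvd ?s (\<beta> - ?d) \<longleftrightarrow> mdvd (mdeg F (Suc i) b) \<beta>"
          using db True unfolding mdvd_def by (auto simp: add.assoc)
        have "\<beta> - ?d - ?s = \<beta> - mdeg F (Suc i) b" if "mdvd (mdeg F (Suc i) b) \<beta>"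
          using db that unfolding mdvd_def by (auto simp: add.assoc)
        then show ?thesis
          unfolding bd lookup_single_times iff using b by (simp add: component_def)
      next
        case False
        have "mdvd ?d (mdeg F (Suc i) b)" if "t \<in> Poly_Mapping.keys (bd F i a b)" for t
          using homogeneous_maps_bd[OF F a b that] unfolding mdvd_def by metis
        then have "Poly_Mapping.keys (bd F i a b) = {}" using False by blast
        then show ?thesis using False by (simp add: coef_def)
      qed
      then show ?thesis
        using a True by (simp add: component_def[of F i] strand_bd_def lookup_sum)
    next
      case False
      moreover have "strand_bd F i (component F (Suc i) \<beta> p) \<in> strand F i \<beta>"
        by (rule graded_mapD(2)[OF graded_map_strand_bd component_strand])
      ultimately have "strand_bd F i (component F (Suc i) \<beta> p) a = 0"
        unfolding strand_iff by blast
      then show ?thesis using False by (simp add: component_def)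
    qed
  qed (simp add: component_def strand_bd_def)
qed

lemma lookup_aug:
  assumes F: "homogeneous_maps F"
  shows "Poly_Mapping.lookup (\<Sum>e\<in>basis F 0. v e * aug F e) \<beta> = strand_aug F (component F 0 \<beta> v)"
proof -
  have "Poly_Mapping.lookup (v e * aug F e) \<beta> =
      Poly_Mapping.lookup (aug F e) (mdeg F 0 e) * component F 0 \<beta> v e" if e: "e \<in> basis F 0" for e
  proof -
    have "Poly_Mapping.keys (aug F e) \<subseteq> {mdeg F 0 e}"
      using F e unfolding homogeneous_maps_def by blast
    then have "aug F e = Poly_Mapping.single (mdeg F 0 e) (Poly_Mapping.lookup (aug F e) (mdeg F 0 e))"
      by (intro poly_mapping_eqI) (auto simp: lookup_single when_def in_keys_iff)
    then have "v e * aug F e =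
        Poly_Mapping.single (mdeg F 0 e) (Poly_Mapping.lookup (aug F e) (mdeg F 0 e)) * v e"
      by (metis mult.commute)
    then show ?thesis
      using e by (simp add: lookup_single_times component_def)
  qed
  then show ?thesis by (simp add: lookup_sum strand_aug_def)
qed

lemma in_image_iff_components:
  assumes F: "homogeneous_maps F"
  shows "(\<exists>w. \<forall>a\<in>basis F i. v a = (\<Sum>b\<in>basis F (Suc i). bd F i a b * w b)) \<longleftrightarrow>
    (\<forall>\<beta>. component F i \<beta> v \<in> strand_bd F i ` strand F (Suc i) \<beta>)"
proof
  assume "\<exists>w. \<forall>a\<in>basis F i. v a = (\<Sum>b\<in>basis F (Suc i). bd F i a b * w b)"
  then obtain w where "\<forall>a\<in>basis F i. v a = (\<Sum>b\<in>basis F (Suc i). bd F i a b * w b)" ..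
  then have "component F i \<beta> v = strand_bd F i (component F (Suc i) \<beta> w)" for \<beta>
    unfolding component_bd[OF F, symmetric] component_eq_iff[symmetric] by blast
  then show "\<forall>\<beta>. component F i \<beta> v \<in> strand_bd F i ` strand F (Suc i) \<beta>"
    using component_strand by blast
next
  assume im: "\<forall>\<beta>. component F i \<beta> v \<in> strand_bd F i ` strand F (Suc i) \<beta>"
  have fin: "finite (basis F i)" using F unfolding homogeneous_maps_def by blast
  \<comment> \<open>The preimage is chosen to be 0 wherever the component is 0; otherwise the chosen
    preimages might not assemble to a polynomial vector.\<close>
  have "\<exists>u. u \<in> strand F (Suc i) \<beta> \<and> component F i \<beta> v = strand_bd F i u \<and>
      (component F i \<beta> v = 0 \<longrightarrow> u = 0)" for \<beta>
  proof (cases "component F i \<beta> v = 0")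
    case True
    then show ?thesis
      using fv.subspace_0[OF subspace_strand] fp.linear_0[OF lin_strand_bd] by metis
  next
    case False
    then show ?thesis using im by blast
  qed
  then obtain u where u: "\<And>\<beta>. u \<beta> \<in> strand F (Suc i) \<beta>"
    "\<And>\<beta>. component F i \<beta> v = strand_bd F i (u \<beta>)" "\<And>\<beta>. component F i \<beta> v = 0 \<Longrightarrow> u \<beta> = 0"
    by metis
  have "{\<beta>. u \<beta> \<noteq> 0} \<subseteq> {\<beta>. component F i \<beta> v \<noteq> 0}" using u(3) by blast
  then have "finite {\<beta>. u \<beta> \<noteq> 0}" using finite_components[OF fin] by (rule finite_subset)
  then obtain w where w: "\<forall>\<beta>. component F (Suc i) \<beta> w = u \<beta>"
    using assemble_components[of u F "Suc i"] u(1) by blast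
  have "component F i \<beta> v = component F i \<beta> (\<lambda>a. \<Sum>b\<in>basis F (Suc i). bd F i a b * w b)" for \<beta>
    unfolding component_bd[OF F] using u(2) w by simp
  then have "\<forall>\<beta>. component F i \<beta> v = component F i \<beta> (\<lambda>a. \<Sum>b\<in>basis F (Suc i). bd F i a b * w b)" ..
  then show "\<exists>w. \<forall>a\<in>basis F i. v a = (\<Sum>b\<in>basis F (Suc i). bd F i a b * w b)"
    unfolding component_eq_iff by (rule exI[of _ w])
qed

lemma in_kernel_iff_components:
  assumes F: "homogeneous_maps F"
  shows "(\<forall>a\<in>basis F i. (\<Sum>b\<in>basis F (Suc i). bd F i a b * v b) = 0) \<longleftrightarrow>
    (\<forall>\<beta>. strand_bd F i (component F (Suc i) \<beta> v) = 0)"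
proof -
  have 0: "component F i \<beta> (\<lambda>a. 0) = 0" for \<beta> by (simp add: component_def fun_eq_iff)
  show ?thesis
    unfolding component_bd[OF F, symmetric]
    using component_eq_iff[of F i "\<lambda>a. \<Sum>b\<in>basis F (Suc i). bd F i a b * v b" "\<lambda>a. 0"]
    unfolding 0 by blast
qed

lemma in_ideal_iff_components:
  assumes F: "homogeneous_maps F" and I: "\<And>p. p \<in> I \<longleftrightarrow> Poly_Mapping.keys p \<subseteq> U"
  shows "(\<Sum>e\<in>basis F 0. v e * aug F e) \<in> I \<longleftrightarrow>
    (\<forall>\<beta>. \<beta> \<in> U \<or> strand_aug F (component F 0 \<beta> v) = 0)"
  unfolding I subset_iff in_keys_iff lookup_aug[OF F] by blast

text \<open>A strand vector is tested by its homogenization: all other components are 0, which is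
  both a cycle and a boundary.\<close>

lemma exact_iff_components:
  "(\<forall>v. (\<forall>\<beta>. component F i \<beta> v \<in> strand_cycles F U i \<beta>) \<longleftrightarrow>
      (\<forall>\<beta>. component F i \<beta> v \<in> strand_bd F i ` strand F (Suc i) \<beta>)) \<longleftrightarrow>
   (\<forall>\<beta>. strand_cycles F U i \<beta> = strand_bd F i ` strand F (Suc i) \<beta>)" (is "?L \<longleftrightarrow> ?R")
proof
  assume L: ?L
  show ?R
  proof
    fix \<beta>
    have zero_cyc: "0 \<in> strand_cycles F U i \<gamma>" for \<gamma>
      using fv.subspace_0[OF subspace_strand, of F i \<gamma>]
      by (simp add: strand_cycles_def fp.linear_0[OF lin_strand_bd] split: nat.split)
    have zero_im: "0 \<in> strand_bd F i ` strand F (Suc i) \<gamma>" for \<gamma>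
      using fv.subspace_0[OF subspace_strand, of F "Suc i" \<gamma>] fp.linear_0[OF lin_strand_bd]
      by (metis imageI)
    have im: "strand_bd F i ` strand F (Suc i) \<beta> \<subseteq> strand F i \<beta>"
      using graded_mapD(2)[OF graded_map_strand_bd] by blast
    have "v \<in> strand_cycles F U i \<beta> \<longleftrightarrow> v \<in> strand_bd F i ` strand F (Suc i) \<beta>"
      if v: "v \<in> strand F i \<beta>" for v
    proof -
      let ?p = "homogenize F i \<beta> v"
      have c: "component F i \<gamma> ?p = (if \<gamma> = \<beta> then v else 0)" for \<gamma>
        by (rule component_homogenize[OF v])
      have "(\<forall>\<gamma>. component F i \<gamma> ?p \<in> strand_cycles F U i \<gamma>) \<longleftrightarrow> v \<in> strand_cycles F U i \<beta>"
        unfolding c using zero_cyc by (metis (full_types))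
      moreover have "(\<forall>\<gamma>. component F i \<gamma> ?p \<in> strand_bd F i ` strand F (Suc i) \<gamma>) \<longleftrightarrow>
          v \<in> strand_bd F i ` strand F (Suc i) \<beta>"
        unfolding c using zero_im by (metis (full_types))
      ultimately show ?thesis using L by blast
    qed
    then show "strand_cycles F U i \<beta> = strand_bd F i ` strand F (Suc i) \<beta>"
      using strand_cycles_subset im by blast
  qed
qed simp

lemma resolution_iff_strandwise_exact:
  assumes I: "\<And>p. p \<in> I \<longleftrightarrow> Poly_Mapping.keys p \<subseteq> U"
  shows "graded_free_resolution F I \<longleftrightarrow> homogeneous_maps F \<and> strandwise_exact F U"
proof (cases "homogeneous_maps F")
  case F: True
  have fin: "finite (basis F i)" for i using F unfolding homogeneous_maps_def by blast
  have exact_0: "(\<forall>v. (\<Sum>e\<in>basis F 0. v e * aug F e) \<in> I \<longleftrightarrow>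
        (\<exists>w. \<forall>a\<in>basis F 0. v a = (\<Sum>b\<in>basis F (Suc 0). bd F 0 a b * w b))) \<longleftrightarrow>
      (\<forall>\<beta>. strand_cycles F U 0 \<beta> = strand_bd F 0 ` strand F (Suc 0) \<beta>)"
    unfolding exact_iff_components[symmetric] in_image_iff_components[OF F]
      in_ideal_iff_components[OF F I]
    by (simp add: strand_cycles_def component_strand)
  have exact_Suc: "(\<forall>v. (\<forall>a\<in>basis F i. (\<Sum>b\<in>basis F (Suc i). bd F i a b * v b) = 0) \<longleftrightarrow>
        (\<exists>w. \<forall>b\<in>basis F (Suc i). v b = (\<Sum>c\<in>basis F (Suc (Suc i)). bd F (Suc i) b c * w c))) \<longleftrightarrow>
      (\<forall>\<beta>. strand_cycles F U (Suc i) \<beta> = strand_bd F (Suc i) ` strand F (Suc (Suc i)) \<beta>)" for i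
    unfolding exact_iff_components[symmetric] in_image_iff_components[OF F]
      in_kernel_iff_components[OF F]
    by (simp add: strand_cycles_def component_strand)
  have surj: "(\<forall>p. \<exists>v. p - (\<Sum>e\<in>basis F 0. v e * aug F e) \<in> I) \<longleftrightarrow>
      (\<forall>\<beta>. \<beta> \<notin> U \<longrightarrow> (\<exists>v\<in>strand F 0 \<beta>. strand_aug F v = 1))" (is "?L \<longleftrightarrow> ?R")
  proof
    assume L: ?L
    show ?R
    proof (intro allI impI)
      fix \<beta> assume \<beta>: "\<beta> \<notin> U"
      \<comment> \<open>The monomial of exponent \<beta> is the test element for surjectivity, since
        it is nonzero in R/I.\<close>
      obtain v where "Poly_Mapping.single \<beta> 1 - (\<Sum>e\<in>basis F 0. v e * aug F e) \<in> I"
        using L by blast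
      then have "\<beta> \<notin> Poly_Mapping.keys (Poly_Mapping.single \<beta> 1 - (\<Sum>e\<in>basis F 0. v e * aug F e))"
        using \<beta> I by blast
      then have "strand_aug F (component F 0 \<beta> v) = 1"
        by (simp add: in_keys_iff lookup_minus lookup_aug[OF F])
      then show "\<exists>v\<in>strand F 0 \<beta>. strand_aug F v = 1"
        using component_strand by blast
    qed
  next
    assume R: ?R
    show ?L
    proof
      fix p
      \<comment> \<open>Scaled preimages are needed only at the exponents of p outside U; taking 0
        elsewhere keeps the family finite.\<close>
      have "\<exists>v. v \<in> strand F 0 \<beta> \<and> (\<beta> \<notin> U \<longrightarrow> strand_aug F v = Poly_Mapping.lookup p \<beta>) \<and>
          (\<beta> \<notin> Poly_Mapping.keys p \<longrightarrow> v = 0)" for \<beta>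
      proof (cases "\<beta> \<in> Poly_Mapping.keys p \<and> \<beta> \<notin> U")
        case True
        then obtain v where v: "v \<in> strand F 0 \<beta>" "strand_aug F v = 1" using R by blast
        have "strand_aug F (\<lambda>x. Poly_Mapping.lookup p \<beta> * v x) = Poly_Mapping.lookup p \<beta>"
          by (simp only: strand_aug_scale v(2) mult_1_right)
        then show ?thesis using fv.subspace_scale[OF subspace_strand v(1)] True by blast
      next
        case False
        then have "\<beta> \<notin> U \<longrightarrow> strand_aug F 0 = Poly_Mapping.lookup p \<beta>"
          by (simp only: strand_aug_0) (auto simp: in_keys_iff)
        then show ?thesis using fv.subspace_0[OF subspace_strand] by blast
      qed
      then obtain v where v: "\<And>\<beta>. v \<beta> \<in> strand F 0 \<beta>"
        "\<And>\<beta>. \<beta> \<notin> U \<Longrightarrow> strand_aug F (v \<beta>) = Poly_Mapping.lookup p \<beta>"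
        "\<And>\<beta>. \<beta> \<notin> Poly_Mapping.keys p \<Longrightarrow> v \<beta> = 0"
        by metis
      have "{\<beta>. v \<beta> \<noteq> 0} \<subseteq> Poly_Mapping.keys p" using v(3) by blast
      then have "finite {\<beta>. v \<beta> \<noteq> 0}" using finite_keys by (rule finite_subset)
      then obtain w where w: "\<forall>\<beta>. component F 0 \<beta> w = v \<beta>"
        using assemble_components[of v F 0] v(1) by blast
      have "\<beta> \<in> U" if "\<beta> \<in> Poly_Mapping.keys (p - (\<Sum>e\<in>basis F 0. w e * aug F e))" for \<beta>
      proof (rule ccontr)
        assume "\<beta> \<notin> U"
        from v(2)[OF this] that show False
          by (simp add: in_keys_iff lookup_minus lookup_aug[OF F] w)
      qed
      then show "\<exists>v. p - (\<Sum>e\<in>basis F 0. v e * aug F e) \<in> I"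
        unfolding I by blast
    qed
  qed
  have all_nat: "(\<forall>i. P i) \<longleftrightarrow> P 0 \<and> (\<forall>i. P (Suc i))" for P :: "nat \<Rightarrow> bool"
    by (metis not0_implies_Suc)
  have "graded_free_resolution F I \<longleftrightarrow>
      (\<forall>p. \<exists>v. p - (\<Sum>e\<in>basis F 0. v e * aug F e) \<in> I) \<and>
      (\<forall>v. (\<Sum>e\<in>basis F 0. v e * aug F e) \<in> I \<longleftrightarrow>
        (\<exists>w. \<forall>a\<in>basis F 0. v a = (\<Sum>b\<in>basis F (Suc 0). bd F 0 a b * w b))) \<and>
      (\<forall>i v. (\<forall>a\<in>basis F i. (\<Sum>b\<in>basis F (Suc i). bd F i a b * v b) = 0) \<longleftrightarrow>
        (\<exists>w. \<forall>b\<in>basis F (Suc i). v b = (\<Sum>c\<in>basis F (Suc (Suc i)). bd F (Suc i) b c * w c)))"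
    using F unfolding graded_free_resolution_def homogeneous_maps_def by blast
  also have "\<dots> \<longleftrightarrow> strandwise_exact F U"
    unfolding surj exact_0 exact_Suc strandwise_exact_def
    unfolding all_nat[of "\<lambda>i. \<forall>\<beta>. strand_cycles F U i \<beta> = strand_bd F i ` strand F (Suc i) \<beta>"]
    using fin by blast
  finally show ?thesis using F by blast
next
  case False
  then show ?thesis
    unfolding graded_free_resolution_def homogeneous_maps_def by blast
qed

text \<open>Justifies the definite description in \<open>betti\<close>: G witnesses existence, and
  the comparison in both directions gives uniqueness of the value.\<close>

lemma betti_eq_tor_dim:
  fixes G :: "('n, 'k::field) graded_complex"
  assumes G: "graded_free_resolution G I" and I: "I = monomial_ideal M"
  shows "betti I i \<alpha> = tor_dim G i \<alpha>"
proof -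
  have exact: "strandwise_exact F (ideal_degrees M)" if "graded_free_resolution F I" for F
  proof -
    have "graded_free_resolution F (monomial_ideal M) \<longleftrightarrow>
        homogeneous_maps F \<and> strandwise_exact F (ideal_degrees M)"
      by (rule resolution_iff_strandwise_exact[OF monomial_ideal_iff])
    then show ?thesis using that I by simp
  qed
  have "tor_dim F i \<alpha> = tor_dim G i \<alpha>" if F: "graded_free_resolution F I" for F
    by (rule antisym[OF tor_dim_le[OF exact[OF F] exact[OF G] ideal_degrees_up]
          tor_dim_le[OF exact[OF G] exact[OF F] ideal_degrees_up]])
  then show ?thesis
    unfolding betti_def
  proof (intro the_equality)
    show "\<exists>F. graded_free_resolution F I \<and> tor_dim G i \<alpha> = tor_dim F i \<alpha>"
      using G by blast
  qed metis
qed

subsection \<open>The Taylor resolution\<close>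

definition face_sign :: "nat \<Rightarrow> nat set \<Rightarrow> 'k::field" where
  "face_sign k \<sigma> = (- 1) ^ card {x \<in> \<sigma>. x < k}"

text \<open>The boundary, not the coboundary: u is the coefficient function of a chain, and the
  coefficient of its boundary at \<sigma> collects contributions from the faces obtained by adding
  one vertex. The empty face is included, so this is the augmented complex.\<close>

definition simplex_bd :: "nat \<Rightarrow> (nat set \<Rightarrow> 'k::field) \<Rightarrow> (nat set \<Rightarrow> 'k)" where
  "simplex_bd q u \<sigma> = (\<Sum>k\<in>{..<q} - \<sigma>. face_sign k \<sigma> * u (insert k \<sigma>))"

text \<open>Coefficients of the join of the chain u with the vertex k; faces of u already containing
  k are dropped.\<close>

definition cone :: "nat \<Rightarrow> (nat set \<Rightarrow> 'k::field) \<Rightarrow> (nat set \<Rightarrow> 'k)" where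
  "cone k u \<tau> = (if k \<in> \<tau> then face_sign k (\<tau> - {k}) * u (\<tau> - {k}) else 0)"

lemma face_sign_insert:
  assumes "finite \<sigma>" "k \<notin> \<sigma>"
  shows "face_sign l (insert k \<sigma>) = (if k < l then - face_sign l \<sigma> else face_sign l \<sigma> :: 'k::field)"
proof -
  have "{x \<in> insert k \<sigma>. x < l} = (if k < l then insert k {x \<in> \<sigma>. x < l} else {x \<in> \<sigma>. x < l})"
    by auto
  then show ?thesis using assms by (simp add: face_sign_def)
qed

lemma face_sign_square: "face_sign k \<sigma> * face_sign k \<sigma> = (1 :: 'k::field)"
  by (simp add: face_sign_def flip: power_mult_distrib)

text \<open>The sum is split into \<open>k < l\<close> and \<open>l < k\<close> and the halves
  cancel. Showing merely that it equals its own negative would not suffice in characteristic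
  2.\<close>

lemma sum_antisym:
  fixes f :: "nat \<Rightarrow> nat \<Rightarrow> 'k::field"
  assumes A: "finite A" and f: "\<And>k l. k \<in> A \<Longrightarrow> l \<in> A \<Longrightarrow> k \<noteq> l \<Longrightarrow> f k l = - f l k"
  shows "(\<Sum>k\<in>A. \<Sum>l\<in>A - {k}. f k l) = 0"
proof -
  have "(\<Sum>l\<in>A - {k}. f k l) = (\<Sum>l\<in>A. if k < l then f k l else 0) + (\<Sum>l\<in>A. if l < k then f k l else 0)"
    if "k \<in> A" for k
  proof -
    have "(\<Sum>l\<in>A - {k}. f k l) = (\<Sum>l\<in>A. if l \<noteq> k then f k l else 0)"
      using A by (intro sum.mono_neutral_cong_left) auto
    also have "\<dots> = (\<Sum>l\<in>A. (if k < l then f k l else 0) + (if l < k then f k l else 0))"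
      by (intro sum.cong refl) auto
    finally show ?thesis by (simp only: sum.distrib)
  qed
  then have "(\<Sum>k\<in>A. \<Sum>l\<in>A - {k}. f k l) = (\<Sum>k\<in>A. \<Sum>l\<in>A. if k < l then f k l else 0) +
      (\<Sum>k\<in>A. \<Sum>l\<in>A. if l < k then f k l else 0)"
    by (simp add: sum.distrib)
  also have "(\<Sum>k\<in>A. \<Sum>l\<in>A. if l < k then f k l else 0) = (\<Sum>l\<in>A. \<Sum>k\<in>A. if l < k then f k l else 0)"
    by (rule sum.swap)
  also have "\<dots> = (\<Sum>k\<in>A. \<Sum>l\<in>A. - (if k < l then f k l else 0))"
  proof (intro sum.cong refl)
    fix k l assume "k \<in> A" "l \<in> A"
    from f[OF this(2,1)] show "(if k < l then f l k else 0) = - (if k < l then f k l else 0)"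
      by (cases "k < l") simp_all
  qed
  finally show ?thesis by (simp add: sum_negf)
qed

lemma simplex_bd_bd:
  assumes \<sigma>: "\<sigma> \<subseteq> {..<q}"
  shows "simplex_bd q (simplex_bd q u) \<sigma> = (0::'k::field)"
proof -
  have fin: "finite \<sigma>" using \<sigma> finite_subset by blast
  let ?A = "{..<q} - \<sigma>"
  let ?f = "\<lambda>k l. face_sign k \<sigma> * (face_sign l (insert k \<sigma>) * u (insert l (insert k \<sigma>))) :: 'k"
  have "simplex_bd q (simplex_bd q u) \<sigma> = (\<Sum>k\<in>?A. \<Sum>l\<in>?A - {k}. ?f k l)"
    unfolding simplex_bd_def sum_distrib_left by (intro sum.cong refl) auto
  also have "\<dots> = 0"
  proof (rule sum_antisym)
    fix k l assume "k \<in> ?A" "l \<in> ?A" "k \<noteq> l"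
    then show "?f k l = - ?f l k"
      using fin by (cases "k < l") (auto simp: face_sign_insert insert_commute)
  qed simp
  finally show ?thesis .
qed

text \<open>The cone fills every cycle. At a face without k only the term adding k survives. At a
  face \<sigma> containing k the sum is, up to sign, the boundary of u at \<sigma> - {k} without its
  k-term; as u is a cycle, that k-term is what remains.\<close>

lemma simplex_bd_cone:
  assumes k: "k < q" and u: "\<And>\<rho>. \<rho> \<subseteq> {..<q} \<Longrightarrow> simplex_bd q u \<rho> = 0" and \<sigma>: "\<sigma> \<subseteq> {..<q}"
  shows "simplex_bd q (cone k u) \<sigma> = (u \<sigma> :: 'k::field)"
proof (cases "k \<in> \<sigma>")
  case False
  have "simplex_bd q (cone k u) \<sigma> = (\<Sum>l\<in>{k}. face_sign l \<sigma> * cone k u (insert l \<sigma>))"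
    unfolding simplex_bd_def using k False by (intro sum.mono_neutral_right) (auto simp: cone_def)
  also have "\<dots> = face_sign k \<sigma> * face_sign k \<sigma> * u \<sigma>"
    using False by (simp add: cone_def mult.assoc)
  finally show ?thesis by (simp add: face_sign_square)
next
  case True
  let ?\<rho> = "\<sigma> - {k}"
  have fin: "finite ?\<rho>" using \<sigma> finite_subset by blast
  have ins: "insert k ?\<rho> = \<sigma>" using True by blast
  let ?S = "\<Sum>l\<in>{..<q} - \<sigma>. face_sign l ?\<rho> * u (insert l ?\<rho>)"
  have "simplex_bd q u ?\<rho> = 0" using \<sigma> by (intro u) blast
  moreover have "{..<q} - ?\<rho> = insert k ({..<q} - \<sigma>)" using k True by blast
  ultimately have S: "?S = - (face_sign k ?\<rho> * u \<sigma>)"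
    unfolding simplex_bd_def using True ins by (simp add: eq_neg_iff_add_eq_0 add.commute)
  have "simplex_bd q (cone k u) \<sigma> = (\<Sum>l\<in>{..<q} - \<sigma>. - face_sign k ?\<rho> * (face_sign l ?\<rho> * u (insert l ?\<rho>)))"
    unfolding simplex_bd_def
  proof (intro sum.cong refl)
    fix l assume l: "l \<in> {..<q} - \<sigma>"
    have 1: "insert l \<sigma> - {k} = insert l ?\<rho>" using l True by blast
    have 2: "face_sign l \<sigma> = (if k < l then - face_sign l ?\<rho> else face_sign l ?\<rho> :: 'k)"
      using face_sign_insert[OF fin, of k l] ins by simp
    have 3: "face_sign k (insert l ?\<rho>) = (if l < k then - face_sign k ?\<rho> else face_sign k ?\<rho> :: 'k)"
      using l by (intro face_sign_insert fin) auto
    have "l \<noteq> k" using l True by blast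
    then have 4: "face_sign l \<sigma> * face_sign k (insert l ?\<rho>) = (- face_sign k ?\<rho> * face_sign l ?\<rho> :: 'k)"
      unfolding 2 3 by auto
    have "face_sign l \<sigma> * cone k u (insert l \<sigma>) =
        face_sign l \<sigma> * face_sign k (insert l ?\<rho>) * u (insert l ?\<rho>)"
      using True by (simp add: cone_def 1 mult.assoc)
    then show "face_sign l \<sigma> * cone k u (insert l \<sigma>) =
        - face_sign k ?\<rho> * (face_sign l ?\<rho> * u (insert l ?\<rho>))"
      unfolding 4 by (simp only: mult.assoc)
  qed
  also have "\<dots> = - face_sign k ?\<rho> * ?S"
    by (simp only: sum_distrib_left)
  also have "\<dots> = face_sign k ?\<rho> * face_sign k ?\<rho> * u \<sigma>"
    unfolding S by (simp add: mult.assoc)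
  finally show ?thesis by (simp add: face_sign_square)
qed

section \<open>Least common multiples, faces and the Taylor complex\<close>

lemma lcm_mon_mdvd_iff:
  assumes "finite \<sigma>"
  shows "mdvd (lcm_mon ms \<sigma>) \<beta> \<longleftrightarrow> (\<forall>i\<in>\<sigma>. mdvd (ms ! i) \<beta>)"
  using assms by (auto simp: mdvd_iff lookup_lcm_mon)

lemma lcm_mon_mono:
  assumes "finite \<tau>" "\<sigma> \<subseteq> \<tau>"
  shows "mdvd (lcm_mon ms \<sigma>) (lcm_mon ms \<tau>)"
proof -
  have "\<forall>i\<in>\<tau>. mdvd (ms ! i) (lcm_mon ms \<tau>)"
    using lcm_mon_mdvd_iff[OF assms(1)] mdvd_refl by blast
  then show ?thesis
    using lcm_mon_mdvd_iff[OF finite_subset[OF assms(2,1)]] assms(2) by blast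
qed

lemma lcm_mon_empty [simp]: "lcm_mon ms {} = 0"
  by (rule poly_mapping_eqI) (simp add: lookup_lcm_mon)

definition faces :: "nat \<Rightarrow> nat \<Rightarrow> nat set set" where
  "faces q i = {\<sigma>. \<sigma> \<subseteq> {..<q} \<and> card \<sigma> = i}"

text \<open>Basis elements of a \<open>graded_complex\<close> are natural numbers, so a face is
  stored as its binary code, the empty face being 0. Between adjacent degrees a proper inclusion
  leaves exactly one vertex, which \<open>the_elem\<close> extracts.\<close>

definition taylor :: "('n::finite) mon list \<Rightarrow> ('n, 'k::field) graded_complex" where
  "taylor ms = \<lparr>basis = (\<lambda>i. set_encode ` faces (length ms) i),
     mdeg = (\<lambda>i e. lcm_mon ms (set_decode e)),
     bd = (\<lambda>i a b. if set_decode a \<subseteq> set_decode b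
       then Poly_Mapping.single (lcm_mon ms (set_decode b) - lcm_mon ms (set_decode a))
         (face_sign (the_elem (set_decode b - set_decode a)) (set_decode a)) else 0),
     aug = (\<lambda>e. 1)\<rparr>"

lemma faces_finite: "\<sigma> \<in> faces q i \<Longrightarrow> finite \<sigma>"
  unfolding faces_def using finite_subset by blast

lemma finite_faces: "finite (faces q i)"
  by (rule finite_subset[of _ "Pow {..<q}"]) (auto simp: faces_def)

lemma set_decode_encode_face: "\<sigma> \<in> faces q i \<Longrightarrow> set_decode (set_encode \<sigma>) = \<sigma>"
  by (simp add: faces_finite)

lemma inj_on_faces: "inj_on set_encode (faces q i)"
  using faces_finite by (intro inj_on_subset[OF inj_on_set_encode]) blast

lemma insert_in_faces: "\<sigma> \<in> faces q i \<Longrightarrow> k \<in> {..<q} - \<sigma> \<Longrightarrow> insert k \<sigma> \<in> faces q (Suc i)"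
  using faces_finite[of \<sigma> q i] by (auto simp: faces_def)

lemma taylor_basis: "basis (taylor ms) i = set_encode ` faces (length ms) i"
  by (simp add: taylor_def)

lemma taylor_mdeg: "mdeg (taylor ms) i e = lcm_mon ms (set_decode e)"
  by (simp add: taylor_def)

lemma taylor_basis_iff:
  "e \<in> basis (taylor ms) i \<longleftrightarrow> set_decode e \<in> faces (length ms) i"
proof
  assume "set_decode e \<in> faces (length ms) i"
  then have "set_encode (set_decode e) \<in> set_encode ` faces (length ms) i" by (rule imageI)
  then show "e \<in> basis (taylor ms) i" by (simp add: taylor_basis)
qed (auto simp: taylor_basis set_decode_encode_face)

lemma taylor_strand_iff:
  "v \<in> strand (taylor ms) i \<beta> \<longleftrightarrow>
    (\<forall>e. v e \<noteq> 0 \<longrightarrow> set_decode e \<in> faces (length ms) i \<and> mdvd (lcm_mon ms (set_decode e)) \<beta>)"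
  by (simp add: strand_iff taylor_basis_iff taylor_mdeg)

text \<open>The strand matrices are the incidence signs of the simplex: the monomials influence only
  which faces belong to a strand.\<close>

lemma taylor_coef:
  "coef (taylor ms) i a b = (if set_decode a \<subseteq> set_decode b
     then face_sign (the_elem (set_decode b - set_decode a)) (set_decode a) else 0)"
  by (simp add: coef_def taylor_def lcm_mon_mono)

lemma taylor_strand_bd:
  assumes \<sigma>: "\<sigma> \<in> faces (length ms) i"
  shows "strand_bd (taylor ms) i v (set_encode \<sigma>) =
    simplex_bd (length ms) (\<lambda>\<tau>. v (set_encode \<tau>)) \<sigma>"
proof -
  let ?q = "length ms"
  let ?A = "{..<?q} - \<sigma>"
  note fin = faces_finite[OF \<sigma>]
  let ?g = "\<lambda>\<tau>. coef (taylor ms) i (set_encode \<sigma>) (set_encode \<tau>) * v (set_encode \<tau>)"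
  have "strand_bd (taylor ms) i v (set_encode \<sigma>) = (\<Sum>\<tau>\<in>faces ?q (Suc i). ?g \<tau>)"
    using \<sigma> by (simp add: strand_bd_def taylor_basis sum.reindex[OF inj_on_faces])
  also have "\<dots> = (\<Sum>\<tau>\<in>(\<lambda>k. insert k \<sigma>) ` ?A. ?g \<tau>)"
  proof (intro sum.mono_neutral_right finite_faces ballI)
    show "(\<lambda>k. insert k \<sigma>) ` ?A \<subseteq> faces ?q (Suc i)"
      using insert_in_faces[OF \<sigma>] by blast
    fix \<tau> assume \<tau>: "\<tau> \<in> faces ?q (Suc i) - (\<lambda>k. insert k \<sigma>) ` ?A"
    have "\<not> \<sigma> \<subseteq> \<tau>"
    proof
      assume sub: "\<sigma> \<subseteq> \<tau>"
      have "card (\<tau> - \<sigma>) = 1"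
        using \<tau> \<sigma> sub fin by (simp add: card_Diff_subset faces_def)
      then obtain k where k: "\<tau> - \<sigma> = {k}" by (rule card_1_singletonE)
      then have "\<tau> = insert k \<sigma>" "k \<in> ?A" using sub \<tau> by (auto simp: faces_def)
      then show False using \<tau> by blast
    qed
    moreover have "finite \<tau>" using \<tau> faces_finite by blast
    ultimately show "?g \<tau> = 0" using fin by (simp add: taylor_coef)
  qed
  also have "\<dots> = (\<Sum>k\<in>?A. ?g (insert k \<sigma>))"
    by (intro sum.reindex_cong[where l = "\<lambda>k. insert k \<sigma>"] inj_onI) auto
  also have "\<dots> = (\<Sum>k\<in>?A. face_sign k \<sigma> * v (set_encode (insert k \<sigma>)))"
  proof (intro sum.cong refl)
    fix k assume k: "k \<in> ?A"
    then have "insert k \<sigma> - \<sigma> = {k}" by blast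
    then show "?g (insert k \<sigma>) = face_sign k \<sigma> * v (set_encode (insert k \<sigma>))"
      using fin by (simp add: taylor_coef subset_insertI del: set_encode_insert)
  qed
  finally show ?thesis by (simp only: simplex_bd_def)
qed

lemma taylor_homogeneous: "homogeneous_maps (taylor ms)"
  unfolding homogeneous_maps_def
proof (intro conjI allI ballI)
  show "finite (basis (taylor ms) i)" for i
    by (simp add: taylor_basis finite_faces)
  show "mdeg (taylor ms) i a + t = mdeg (taylor ms) (Suc i) b"
    if "t \<in> Poly_Mapping.keys (bd (taylor ms) i a b)" for i a b t
    using that mdvd_diff[OF lcm_mon_mono[OF finite_set_decode]]
    by (simp add: taylor_def split: if_splits)
  fix e assume "e \<in> basis (taylor ms) 0"
  then have "set_decode e = {}"
    by (auto simp: taylor_basis_iff faces_def)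
  then show "Poly_Mapping.keys (aug (taylor ms) e) \<subseteq> {mdeg (taylor ms) 0 e}"
    by (simp add: taylor_def)
qed

lemma taylor_basis_0: "basis (taylor ms) 0 = {0}"
proof -
  have "faces (length ms) 0 = {{}}"
    unfolding faces_def using finite_subset[of _ "{..<length ms}"] by auto
  then show ?thesis by (simp add: taylor_basis)
qed

lemma taylor_strand_aug: "strand_aug (taylor ms) v = v 0"
  unfolding strand_aug_def taylor_basis_0 by (simp add: taylor_def)

text \<open>The strand at \<beta> is the augmented chain complex of the full simplex on the vertices
  whose generators divide \<beta>. If there are such vertices it is a cone, hence exact; otherwise
  only the empty face remains, and it maps isomorphically onto the component of R/I.\<close>

lemma taylor_strandwise_exact: "strandwise_exact (taylor ms) (ideal_degrees (set ms))"
  unfolding strandwise_exact_def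
proof (intro conjI allI impI)
  let ?T = "taylor ms :: ('a, 'b) graded_complex"
  let ?q = "length ms"
  let ?U = "ideal_degrees (set ms)"
  show "finite (basis ?T i)" for i
    by (simp add: taylor_basis finite_faces)
  show "\<exists>v\<in>strand ?T 0 \<beta>. strand_aug ?T v = 1" for \<beta>
  proof
    show "strand_aug ?T (unit_vec 0) = 1"
      by (simp add: taylor_strand_aug unit_vec_def)
    show "unit_vec 0 \<in> strand ?T 0 \<beta>"
      by (rule unit_vec_strand) (simp_all add: taylor_basis_0 taylor_mdeg mdvd_iff)
  qed
  have nonface: "\<beta> \<in> ?U" if v: "v \<in> strand ?T (Suc i) \<beta>" "v e \<noteq> 0" for v :: "nat \<Rightarrow> 'b" and e i \<beta>
  proof -
    have f: "set_decode e \<in> faces ?q (Suc i)" "mdvd (lcm_mon ms (set_decode e)) \<beta>"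
      using v unfolding taylor_strand_iff by blast+
    then have "set_decode e \<noteq> {}" by (auto simp: faces_def)
    then obtain k where k: "k \<in> set_decode e" by blast
    then have "mdvd (ms ! k) \<beta>" using f(2) lcm_mon_mdvd_iff[OF finite_set_decode] by blast
    moreover have "ms ! k \<in> set ms" using k f(1) by (auto simp: faces_def)
    ultimately show ?thesis unfolding ideal_degrees_def by blast
  qed
  fix i \<beta>
  show "strand_cycles ?T ?U i \<beta> = strand_bd ?T i ` strand ?T (Suc i) \<beta>"
  proof (intro set_eqI iffI)
    fix v assume "v \<in> strand_bd ?T i ` strand ?T (Suc i) \<beta>"
    then obtain w where w: "w \<in> strand ?T (Suc i) \<beta>" and v: "v = strand_bd ?T i w" by blast
    have vs: "v \<in> strand ?T i \<beta>"
      unfolding v by (rule graded_mapD(2)[OF graded_map_strand_bd w])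
    show "v \<in> strand_cycles ?T ?U i \<beta>"
    proof (cases i)
      case 0
      have "\<beta> \<in> ?U \<or> v = 0"
      proof (cases "w = 0")
        case True
        then show ?thesis unfolding v using fp.linear_0[OF lin_strand_bd] by blast
      next
        case False
        then obtain e where "w e \<noteq> 0" unfolding fun_eq_iff by auto
        then show ?thesis using nonface w by blast
      qed
      then show ?thesis using vs 0 by (auto simp: strand_cycles_def)
    next
      case (Suc j)
      have "strand_bd ?T j v a = 0" for a
      proof (cases "a \<in> basis ?T j")
        case True
        then obtain \<sigma> where \<sigma>: "\<sigma> \<in> faces ?q j" "a = set_encode \<sigma>"
          by (auto simp: taylor_basis)
        have "strand_bd ?T j v a = simplex_bd ?q (\<lambda>\<tau>. v (set_encode \<tau>)) \<sigma>"
          unfolding \<sigma>(2) by (rule taylor_strand_bd[OF \<sigma>(1)])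
        also have "\<dots> = simplex_bd ?q (simplex_bd ?q (\<lambda>\<tau>. w (set_encode \<tau>))) \<sigma>"
          unfolding simplex_bd_def[of _ _ \<sigma>]
        proof (intro sum.cong refl arg_cong2[where f = "(*)"])
          fix k assume "k \<in> {..<?q} - \<sigma>"
          then have "insert k \<sigma> \<in> faces ?q i" using insert_in_faces[OF \<sigma>(1)] Suc by blast
          then show "v (set_encode (insert k \<sigma>)) = simplex_bd ?q (\<lambda>\<tau>. w (set_encode \<tau>)) (insert k \<sigma>)"
            unfolding v by (rule taylor_strand_bd)
        qed
        also have "\<dots> = 0" using \<sigma>(1) by (intro simplex_bd_bd) (auto simp: faces_def)
        finally show ?thesis .
      qed (simp add: strand_bd_def)
      then have "strand_bd ?T j v = 0" unfolding fun_eq_iff by simp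
      then show ?thesis using vs Suc by (simp add: strand_cycles_def)
    qed
  next
    fix v assume cyc: "v \<in> strand_cycles ?T ?U i \<beta>"
    then have v: "v \<in> strand ?T i \<beta>" using strand_cycles_subset by blast
    show "v \<in> strand_bd ?T i ` strand ?T (Suc i) \<beta>"
    proof (cases "\<beta> \<in> ?U")
      case False
      have "v e = 0" for e
      proof (cases i)
        case 0
        then have "v 0 = 0" using cyc False by (simp add: strand_cycles_def taylor_strand_aug)
        moreover have "v e = 0" if "e \<noteq> 0"
        proof (rule ccontr)
          assume "v e \<noteq> 0"
          then have "e \<in> basis ?T 0" using v[unfolded 0 strand_iff] by blast
          then show False using that by (simp add: taylor_basis_0)
        qed
        ultimately show ?thesis by (cases "e = 0") simp_all
      next
        case (Suc j)
        then show ?thesis using nonface v False by blast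
      qed
      then have "v = 0" unfolding fun_eq_iff by simp
      then have "v = strand_bd ?T i 0" using fp.linear_0[OF lin_strand_bd] by metis
      moreover have "0 \<in> strand ?T (Suc i) \<beta>" by (rule fv.subspace_0[OF subspace_strand])
      ultimately show ?thesis by (rule image_eqI)
    next
      case True
      \<comment> \<open>This vertex is the apex of the cone.\<close>
      then obtain k where k: "k < ?q" "mdvd (ms ! k) \<beta>"
        by (auto simp: ideal_degrees_def in_set_conv_nth)
      let ?u = "\<lambda>\<tau>. v (set_encode \<tau>)"
      \<comment> \<open>The cycle condition speaks only of faces with one element less than i. For a
        \<rho> of any other size, adding a vertex gives a face outside the support of v.\<close>
      have u: "simplex_bd ?q ?u \<rho> = 0" if \<rho>: "\<rho> \<subseteq> {..<?q}" for \<rho>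
      proof (cases "Suc (card \<rho>) = i")
        case True
        have "strand_bd ?T (card \<rho>) v = 0" using cyc True[symmetric] by (simp add: strand_cycles_def)
        moreover have "\<rho> \<in> faces ?q (card \<rho>)" using \<rho> by (simp add: faces_def)
        ultimately show ?thesis using taylor_strand_bd[of \<rho> ms "card \<rho>" v] by simp
      next
        case False
        have fin: "finite \<rho>" using \<rho> finite_subset by blast
        have "?u (insert l \<rho>) = 0" if "l \<in> {..<?q} - \<rho>" for l
        proof (rule ccontr)
          assume "?u (insert l \<rho>) \<noteq> 0"
          then have "set_decode (set_encode (insert l \<rho>)) \<in> faces ?q i"
            using v unfolding taylor_strand_iff by blast
          then have "card (insert l \<rho>) = i"
            using fin by (simp add: faces_def del: set_encode_insert)
          then show False using False fin that by simp
        qed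
        then show ?thesis unfolding simplex_bd_def by (intro sum.neutral) auto
      qed
      define w where "w e = (if set_decode e \<in> faces ?q (Suc i) then cone k ?u (set_decode e) else 0)" for e
      have "w \<in> strand ?T (Suc i) \<beta>"
        unfolding taylor_strand_iff
      proof (intro allI impI)
        fix e assume we: "w e \<noteq> 0"
        let ?\<tau> = "set_decode e"
        have f: "?\<tau> \<in> faces ?q (Suc i)" "cone k ?u ?\<tau> \<noteq> 0"
          using we by (auto simp: w_def split: if_splits)
        then have "?u (?\<tau> - {k}) \<noteq> 0" by (auto simp: cone_def split: if_splits)
        then have "mdvd (lcm_mon ms (set_decode (set_encode (?\<tau> - {k})))) \<beta>"
          using v unfolding taylor_strand_iff by blast
        then have "\<forall>l\<in>?\<tau> - {k}. mdvd (ms ! l) \<beta>"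
          by (simp add: lcm_mon_mdvd_iff)
        \<comment> \<open>Joining with k stays in the strand because the generator at k divides
          \<beta>.\<close>
        then have "mdvd (lcm_mon ms ?\<tau>) \<beta>"
          unfolding lcm_mon_mdvd_iff[OF finite_set_decode] using k(2) by blast
        then show "?\<tau> \<in> faces ?q (Suc i) \<and> mdvd (lcm_mon ms ?\<tau>) \<beta>" using f(1) by blast
      qed
      moreover have "v = strand_bd ?T i w"
      proof
        fix a
        show "v a = strand_bd ?T i w a"
        proof (cases "a \<in> basis ?T i")
          case True
          then obtain \<sigma> where \<sigma>: "\<sigma> \<in> faces ?q i" "a = set_encode \<sigma>"
            by (auto simp: taylor_basis)
          have "strand_bd ?T i w a = simplex_bd ?q (\<lambda>\<tau>. w (set_encode \<tau>)) \<sigma>"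
            unfolding \<sigma>(2) by (rule taylor_strand_bd[OF \<sigma>(1)])
          also have "\<dots> = simplex_bd ?q (cone k ?u) \<sigma>"
            unfolding simplex_bd_def[of _ _ \<sigma>]
          proof (intro sum.cong refl arg_cong2[where f = "(*)"])
            fix l assume "l \<in> {..<?q} - \<sigma>"
            then have "insert l \<sigma> \<in> faces ?q (Suc i)" by (rule insert_in_faces[OF \<sigma>(1)])
            then show "w (set_encode (insert l \<sigma>)) = cone k ?u (insert l \<sigma>)"
              unfolding w_def by (simp only: set_decode_encode_face if_True)
          qed
          also have "\<dots> = v a"
            unfolding \<sigma>(2) using \<sigma>(1) by (intro simplex_bd_cone k(1) u) (auto simp: faces_def)
          finally show ?thesis ..
        next
          case False
          then have "v a = 0" using v unfolding strand_iff by blast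
          then show ?thesis using False by (simp add: strand_bd_def)
        qed
      qed
      ultimately show ?thesis by blast
    qed
  qed
qed

lemma taylor_resolution: "graded_free_resolution (taylor ms) (monomial_ideal (set ms))"
  using resolution_iff_strandwise_exact[OF monomial_ideal_iff] taylor_homogeneous taylor_strandwise_exact
  by blast

subsection \<open>The pruning matching\<close>

text \<open>Rank-nullity in each degree, where \<open>fv.dim (tor_boundaries F i \<alpha>)\<close>
  is the rank of the differential from degree i + 1 to degree i. The additive form avoids truncated
  subtraction.\<close>

lemma dim_tor_cycles:
  fixes F :: "('n, 'k::field) graded_complex"
  assumes F: "strandwise_exact F U"
  shows "tor_dim F 0 \<alpha> + fv.dim (tor_boundaries F 0 \<alpha>) = card (basis_at F 0 \<alpha>)"
    and "tor_dim F (Suc i) \<alpha> + fv.dim (tor_boundaries F i \<alpha>) + fv.dim (tor_boundaries F (Suc i) \<alpha>) =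
      card (basis_at F (Suc i) \<alpha>)"
proof -
  have fin: "finite (basis_at F i \<alpha>)" for i
    using F unfolding strandwise_exact_def by (intro finite_basis_at) blast
  have span: "tor_chains F i \<alpha> \<subseteq> fv.span (unit_vec ` basis_at F i \<alpha>)" for i
    unfolding tor_chains_eq by (rule supported_on_span[OF fin])
  have dim: "fv.dim (tor_chains F i \<alpha>) = card (basis_at F i \<alpha>)" for i
    unfolding tor_chains_eq by (rule dim_supported_on[OF fin])
  have le: "fv.dim (tor_boundaries F i \<alpha>) \<le> fv.dim (tor_cycles F i \<alpha>)" for i
    by (rule fv.dim_subspace_mono[OF subspace_tor_boundaries tor_boundaries_subset[OF F]
          subset_trans[OF tor_cycles_subset span] finite_imageI[OF fin]])
  have "tor_cycles F 0 \<alpha> = tor_chains F 0 \<alpha>"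
    by (simp add: tor_cycles_def)
  then show "tor_dim F 0 \<alpha> + fv.dim (tor_boundaries F 0 \<alpha>) = card (basis_at F 0 \<alpha>)"
    using le[of 0] dim[of 0] by (simp add: tor_dim_def)
  have "fv.dim {v \<in> tor_chains F (Suc i) \<alpha>. tor_bd F i \<alpha> v = 0} +
      fv.dim (tor_bd F i \<alpha> ` tor_chains F (Suc i) \<alpha>) = fv.dim (tor_chains F (Suc i) \<alpha>)"
    by (rule fv.rank_nullity[OF lin_tor_bd subspace_tor_chains span finite_imageI[OF fin]])
  moreover have "tor_cycles F (Suc i) \<alpha> = {v \<in> tor_chains F (Suc i) \<alpha>. tor_bd F i \<alpha> v = 0}"
    by (simp add: tor_cycles_def)
  ultimately have "fv.dim (tor_cycles F (Suc i) \<alpha>) + fv.dim (tor_boundaries F i \<alpha>) =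
      card (basis_at F (Suc i) \<alpha>)"
    by (simp only: tor_boundaries_def dim)
  then show "tor_dim F (Suc i) \<alpha> + fv.dim (tor_boundaries F i \<alpha>) +
      fv.dim (tor_boundaries F (Suc i) \<alpha>) = card (basis_at F (Suc i) \<alpha>)"
    using le[of "Suc i"] by (simp add: tor_dim_def)
qed

section \<open>Selected edges and critical faces\<close>

definition matched :: "('n::finite) mon list \<Rightarrow> nat \<Rightarrow> nat set \<Rightarrow> bool" where
  "matched ms j \<tau> \<longleftrightarrow> \<tau> \<in> \<Union>(prune_step ms j)"

lemma pruned_before_iff: "\<tau> \<in> \<Union>(pruned_before ms n) \<longleftrightarrow> (\<exists>j<n. matched ms j \<tau>)"
proof (induction n)
  case (Suc n)
  have "\<tau> \<in> \<Union>(pruned_before ms (Suc n)) \<longleftrightarrow> \<tau> \<in> \<Union>(pruned_before ms n) \<or> matched ms n \<tau>"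
    by (auto simp: matched_def prune_step_def)
  then show ?case using Suc by (auto simp: less_Suc_eq)
qed simp

text \<open>A recursion on steps that treats both ends of an edge alike: whichever end \<tau> is,
  the ends are \<open>\<tau> - {j}\<close> and \<open>insert j \<tau>\<close>.\<close>

lemma matched_iff:
  "matched ms j \<tau> \<longleftrightarrow> insert j \<tau> - {j} \<subseteq> {..<length ms} \<and> lcm_mon ms (\<tau> - {j}) = lcm_mon ms (insert j \<tau>) \<and>
    (\<forall>k<j. \<not> matched ms k (\<tau> - {j}) \<and> \<not> matched ms k (insert j \<tau>))" (is "_ \<longleftrightarrow> ?R \<tau>")
proof
  assume "matched ms j \<tau>"
  then obtain \<sigma> where \<sigma>: "\<sigma> \<subseteq> {..<length ms}" "j \<notin> \<sigma>" "lcm_mon ms \<sigma> = lcm_mon ms (insert j \<sigma>)"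
    "\<sigma> \<notin> \<Union>(pruned_before ms j)" "insert j \<sigma> \<notin> \<Union>(pruned_before ms j)" "\<tau> = \<sigma> \<or> \<tau> = insert j \<sigma>"
    unfolding matched_def prune_step_def new_edges_def by blast
  then have "\<tau> - {j} = \<sigma>" "insert j \<tau> = insert j \<sigma>" "insert j \<tau> - {j} = \<sigma>" by auto
  then show "?R \<tau>" using \<sigma> unfolding pruned_before_iff by simp
next
  assume R: "?R \<tau>"
  let ?\<sigma> = "\<tau> - {j}"
  have 1: "insert j ?\<sigma> = insert j \<tau>" by blast
  have "{?\<sigma>, insert j ?\<sigma>} \<in> prune_step ms j"
    unfolding prune_step_def new_edges_def mem_Collect_eq pruned_before_iff
    by (rule exI[of _ ?\<sigma>]) (use R in \<open>auto simp: 1\<close>)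
  moreover have "\<tau> \<in> {?\<sigma>, insert j ?\<sigma>}" by auto
  ultimately show "matched ms j \<tau>" unfolding matched_def by blast
qed

lemma matched_insert: "matched ms j (insert j \<tau>) \<longleftrightarrow> matched ms j \<tau>"
  unfolding matched_iff[of ms j "insert j \<tau>"] matched_iff[of ms j \<tau>] by simp

lemma matched_remove: "matched ms j (\<tau> - {j}) \<longleftrightarrow> matched ms j \<tau>"
  unfolding matched_iff[of ms j "\<tau> - {j}"] matched_iff[of ms j \<tau>] by simp

text \<open>Of two steps matching the same face, the later one would have found it already
  used.\<close>

lemma matched_unique:
  assumes "matched ms j \<tau>" "matched ms k \<tau>"
  shows "j = k"
proof -
  have "\<not> k < j" if "matched ms j \<tau>" "matched ms k \<tau>" for j k
  proof (cases "j \<in> \<tau>")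
    case True
    then have "insert j \<tau> = \<tau>" by blast
    then show ?thesis using that matched_iff[of ms j \<tau>] by metis
  next
    case False
    then have "\<tau> - {j} = \<tau>" by blast
    then show ?thesis using that matched_iff[of ms j \<tau>] by metis
  qed
  from this[OF assms] this[OF assms(2,1)] show ?thesis by simp
qed

lemma matched_lcm:
  assumes "matched ms j \<tau>"
  shows "lcm_mon ms (insert j \<tau>) = lcm_mon ms \<tau>" "lcm_mon ms (\<tau> - {j}) = lcm_mon ms \<tau>"
proof -
  have eq: "lcm_mon ms (\<tau> - {j}) = lcm_mon ms (insert j \<tau>)" using assms matched_iff by blast
  have "insert j \<tau> = \<tau> \<or> \<tau> - {j} = \<tau>" by blast
  with eq show "lcm_mon ms (insert j \<tau>) = lcm_mon ms \<tau>" "lcm_mon ms (\<tau> - {j}) = lcm_mon ms \<tau>"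
    by metis+
qed

text \<open>Each selected edge is counted by its upper end. The index i is the size of the lower
  end, so that these numbers are compared with the rank of the differential from degree i + 1 to
  degree i.\<close>

definition upper_faces :: "('n::finite) mon list \<Rightarrow> nat \<Rightarrow> 'n mon \<Rightarrow> nat set set" where
  "upper_faces ms i \<alpha> = {\<tau> \<in> faces (length ms) (Suc i).
     lcm_mon ms \<tau> = \<alpha> \<and> (\<exists>j<length ms. j \<in> \<tau> \<and> matched ms j \<tau>)}"

definition lower_faces :: "('n::finite) mon list \<Rightarrow> nat \<Rightarrow> 'n mon \<Rightarrow> nat set set" where
  "lower_faces ms i \<alpha> = {\<sigma> \<in> faces (length ms) i.
     lcm_mon ms \<sigma> = \<alpha> \<and> (\<exists>j<length ms. j \<notin> \<sigma> \<and> matched ms j \<sigma>)}"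

definition step_of :: "('n::finite) mon list \<Rightarrow> nat set \<Rightarrow> nat" where
  "step_of ms \<tau> = (THE j. matched ms j \<tau>)"

lemma step_of_eq: "matched ms j \<tau> \<Longrightarrow> step_of ms \<tau> = j"
  unfolding step_of_def using matched_unique by (intro the_equality) blast+

lemma upper_facesE:
  assumes "\<tau> \<in> upper_faces ms i \<alpha>"
  shows "\<tau> \<in> faces (length ms) (Suc i)" "lcm_mon ms \<tau> = \<alpha>" "step_of ms \<tau> < length ms"
    "step_of ms \<tau> \<in> \<tau>" "matched ms (step_of ms \<tau>) \<tau>"
proof -
  obtain j where "j < length ms" "j \<in> \<tau>" "matched ms j \<tau>"
    using assms unfolding upper_faces_def by blast
  then show "step_of ms \<tau> < length ms" "step_of ms \<tau> \<in> \<tau>" "matched ms (step_of ms \<tau>) \<tau>"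
    using step_of_eq by blast+
qed (use assms in \<open>auto simp: upper_faces_def\<close>)

lemma upper_faces_remove:
  assumes \<tau>: "\<tau> \<in> upper_faces ms i \<alpha>"
  shows "\<tau> - {step_of ms \<tau>} \<in> faces (length ms) i" "lcm_mon ms (\<tau> - {step_of ms \<tau>}) = \<alpha>"
    "matched ms (step_of ms \<tau>) (\<tau> - {step_of ms \<tau>})"
proof -
  note u = upper_facesE[OF \<tau>]
  show "\<tau> - {step_of ms \<tau>} \<in> faces (length ms) i"
    using u(1,4) faces_finite[OF u(1)] by (auto simp: faces_def)
  show "lcm_mon ms (\<tau> - {step_of ms \<tau>}) = \<alpha>"
    using matched_lcm(2)[OF u(5)] u(2) by simp
  show "matched ms (step_of ms \<tau>) (\<tau> - {step_of ms \<tau>})"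
    using u(5) matched_remove by blast
qed

lemma card_upper_lower: "card (upper_faces ms i \<alpha>) = card (lower_faces ms i \<alpha>)"
proof (rule bij_betw_same_card)
  show "bij_betw (\<lambda>\<tau>. \<tau> - {step_of ms \<tau>}) (upper_faces ms i \<alpha>) (lower_faces ms i \<alpha>)"
  proof (rule bij_betw_byWitness[where f' = "\<lambda>\<sigma>. insert (step_of ms \<sigma>) \<sigma>"])
    show "\<forall>\<tau>\<in>upper_faces ms i \<alpha>. insert (step_of ms (\<tau> - {step_of ms \<tau>})) (\<tau> - {step_of ms \<tau>}) = \<tau>"
    proof
      fix \<tau> assume \<tau>: "\<tau> \<in> upper_faces ms i \<alpha>"
      have "step_of ms (\<tau> - {step_of ms \<tau>}) = step_of ms \<tau>"
        by (rule step_of_eq[OF upper_faces_remove(3)[OF \<tau>]])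
      then show "insert (step_of ms (\<tau> - {step_of ms \<tau>})) (\<tau> - {step_of ms \<tau>}) = \<tau>"
        using upper_facesE(4)[OF \<tau>] by (simp add: insert_absorb)
    qed
    have lower: "step_of ms \<sigma> = j \<and> step_of ms (insert j \<sigma>) = j \<and> insert j \<sigma> \<in> upper_faces ms i \<alpha>"
      if \<sigma>: "\<sigma> \<in> faces (length ms) i" "lcm_mon ms \<sigma> = \<alpha>" and j: "j < length ms" "j \<notin> \<sigma>" "matched ms j \<sigma>" for \<sigma> j
    proof (intro conjI step_of_eq)
      show ins: "matched ms j (insert j \<sigma>)" using j(3) matched_insert by blast
      have "insert j \<sigma> \<in> faces (length ms) (Suc i)" using insert_in_faces[OF \<sigma>(1)] j by blast
      moreover have "lcm_mon ms (insert j \<sigma>) = \<alpha>" using matched_lcm(1)[OF j(3)] \<sigma>(2) by simp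
      ultimately show "insert j \<sigma> \<in> upper_faces ms i \<alpha>"
        using ins j(1) unfolding upper_faces_def by blast
    qed (rule j(3))
    show "\<forall>\<sigma>\<in>lower_faces ms i \<alpha>. insert (step_of ms \<sigma>) \<sigma> - {step_of ms (insert (step_of ms \<sigma>) \<sigma>)} = \<sigma>"
    proof
      fix \<sigma> assume "\<sigma> \<in> lower_faces ms i \<alpha>"
      then obtain j where j: "\<sigma> \<in> faces (length ms) i" "lcm_mon ms \<sigma> = \<alpha>" "j < length ms" "j \<notin> \<sigma>" "matched ms j \<sigma>"
        unfolding lower_faces_def by blast
      from lower[OF this] j(4)
      show "insert (step_of ms \<sigma>) \<sigma> - {step_of ms (insert (step_of ms \<sigma>) \<sigma>)} = \<sigma>" by simp
    qed
    show "(\<lambda>\<tau>. \<tau> - {step_of ms \<tau>}) ` upper_faces ms i \<alpha> \<subseteq> lower_faces ms i \<alpha>"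
    proof (rule image_subsetI)
      fix \<tau> assume \<tau>: "\<tau> \<in> upper_faces ms i \<alpha>"
      show "\<tau> - {step_of ms \<tau>} \<in> lower_faces ms i \<alpha>"
        using upper_faces_remove[OF \<tau>] upper_facesE(3)[OF \<tau>] unfolding lower_faces_def by blast
    qed
    show "(\<lambda>\<sigma>. insert (step_of ms \<sigma>) \<sigma>) ` lower_faces ms i \<alpha> \<subseteq> upper_faces ms i \<alpha>"
    proof (rule image_subsetI)
      fix \<sigma> assume "\<sigma> \<in> lower_faces ms i \<alpha>"
      then obtain j where "\<sigma> \<in> faces (length ms) i" "lcm_mon ms \<sigma> = \<alpha>" "j < length ms" "j \<notin> \<sigma>" "matched ms j \<sigma>"
        unfolding lower_faces_def by blast
      from lower[OF this] show "insert (step_of ms \<sigma>) \<sigma> \<in> upper_faces ms i \<alpha>" by simp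
    qed
  qed
qed

definition faces_at :: "('n::finite) mon list \<Rightarrow> nat \<Rightarrow> 'n mon \<Rightarrow> nat set set" where
  "faces_at ms i \<alpha> = {\<sigma> \<in> faces (length ms) i. lcm_mon ms \<sigma> = \<alpha>}"

definition critical_at :: "('n::finite) mon list \<Rightarrow> nat \<Rightarrow> 'n mon \<Rightarrow> nat set set" where
  "critical_at ms i \<alpha> = {\<sigma> \<in> critical_faces ms. card \<sigma> = i \<and> lcm_mon ms \<sigma> = \<alpha>}"

lemma critical_at_eq: "critical_at ms i \<alpha> = {\<sigma> \<in> faces_at ms i \<alpha>. \<not> (\<exists>j<length ms. matched ms j \<sigma>)}"
  unfolding critical_at_def critical_faces_def faces_at_def faces_def Diff_iff pruned_before_iff by blast

lemma finite_faces_at: "finite (faces_at ms i \<alpha>)"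
  unfolding faces_at_def by (simp add: finite_faces)

text \<open>A face is critical, an upper end or a lower end, and only one of these. The result has
  the shape of \<open>dim_tor_cycles\<close>, with critical faces in place of Tor and edges in place
  of ranks.\<close>

lemma card_faces_at:
  "card (faces_at ms 0 \<alpha>) = card (critical_at ms 0 \<alpha>) + card (upper_faces ms 0 \<alpha>)"
  "card (faces_at ms (Suc i) \<alpha>) =
    card (critical_at ms (Suc i) \<alpha>) + card (upper_faces ms i \<alpha>) + card (upper_faces ms (Suc i) \<alpha>)"
proof -
  have fin: "finite (critical_at ms i \<alpha>)" "finite (lower_faces ms i \<alpha>)" "finite (upper_faces ms i \<alpha>)" for i
    unfolding critical_at_eq lower_faces_def upper_faces_def by (simp_all add: finite_faces finite_faces_at)
  \<comment> \<open>The empty face has no vertex to remove, so it cannot be an upper end.\<close>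
  have "faces_at ms 0 \<alpha> = critical_at ms 0 \<alpha> \<union> lower_faces ms 0 \<alpha>"
    unfolding critical_at_eq lower_faces_def faces_at_def using faces_finite
    by (auto simp: faces_def)
  moreover have "critical_at ms i \<alpha> \<inter> lower_faces ms i \<alpha> = {}" for i
    unfolding critical_at_eq lower_faces_def by blast
  ultimately show "card (faces_at ms 0 \<alpha>) = card (critical_at ms 0 \<alpha>) + card (upper_faces ms 0 \<alpha>)"
    by (simp add: card_Un_disjoint fin card_upper_lower)
  have eq: "faces_at ms (Suc i) \<alpha> = (critical_at ms (Suc i) \<alpha> \<union> upper_faces ms i \<alpha>) \<union> lower_faces ms (Suc i) \<alpha>"
    unfolding critical_at_eq lower_faces_def faces_at_def upper_faces_def by blast
  have dis1: "critical_at ms (Suc i) \<alpha> \<inter> upper_faces ms i \<alpha> = {}"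
    unfolding critical_at_eq upper_faces_def by blast
  have dis2: "(critical_at ms (Suc i) \<alpha> \<union> upper_faces ms i \<alpha>) \<inter> lower_faces ms (Suc i) \<alpha> = {}"
    unfolding critical_at_eq lower_faces_def upper_faces_def using matched_unique by blast
  show "card (faces_at ms (Suc i) \<alpha>) =
    card (critical_at ms (Suc i) \<alpha>) + card (upper_faces ms i \<alpha>) + card (upper_faces ms (Suc i) \<alpha>)"
    unfolding eq by (simp add: card_Un_disjoint dis1 dis2 fin card_upper_lower)
qed

text \<open>The matching is acyclic: in a closed alternating path, take an edge of least step \<open>j\<close>. The
  path leaves the faces containing \<open>j\<close> along this edge, but it cannot come back to them, because the
  edge along which it does would have been selected at step \<open>j\<close>.\<close>

lemma matching_acyclic:
  assumes "finite S" "S \<subseteq> upper_faces ms i \<alpha>"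
    and "\<And>\<tau>. \<tau> \<in> S \<Longrightarrow> \<exists>\<tau>'\<in>S. \<tau>' \<noteq> \<tau> \<and> \<tau> - {step_of ms \<tau>} \<subseteq> \<tau>'"
  shows "S = {}"
  using assms
proof (induction "card S" arbitrary: S rule: less_induct)
  case less
  show ?case
  proof (rule ccontr)
    assume "S \<noteq> {}"
    define j where "j = Min (step_of ms ` S)"
    have "j \<in> step_of ms ` S"
      unfolding j_def using \<open>S \<noteq> {}\<close> less.prems(1) by (intro Min_in) auto
    then obtain \<tau>0 where \<tau>0: "\<tau>0 \<in> S" "step_of ms \<tau>0 = j" by blast
    have min: "j \<le> step_of ms \<tau>" if "\<tau> \<in> S" for \<tau>
      unfolding j_def using that less.prems(1) by (intro Min_le) auto
    have no_entry: "j \<in> \<tau> - {step_of ms \<tau>}"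
      if "\<tau> \<in> S" "\<tau>' \<in> S" "\<tau>' \<noteq> \<tau>" "\<tau> - {step_of ms \<tau>} \<subseteq> \<tau>'" "j \<in> \<tau>'" for \<tau> \<tau>'
    proof (rule ccontr)
      let ?\<sigma> = "\<tau> - {step_of ms \<tau>}"
      assume j: "j \<notin> ?\<sigma>"
      have \<tau>: "\<tau> \<in> upper_faces ms i \<alpha>" and \<tau>': "\<tau>' \<in> upper_faces ms i \<alpha>"
        using that less.prems(2) by blast+
      have \<sigma>: "?\<sigma> \<in> faces (length ms) i" "lcm_mon ms ?\<sigma> = \<alpha>" "matched ms (step_of ms \<tau>) ?\<sigma>"
        by (rule upper_faces_remove[OF \<tau>])+
      have "insert j ?\<sigma> = \<tau>'"
      proof (rule card_subset_eq)
        show "finite \<tau>'" using upper_facesE(1)[OF \<tau>'] faces_finite by blast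
        show "insert j ?\<sigma> \<subseteq> \<tau>'" using that(4,5) by blast
        have "card (insert j ?\<sigma>) = Suc (card ?\<sigma>)"
          using faces_finite[OF \<sigma>(1)] j by (rule card_insert_disjoint)
        then show "card (insert j ?\<sigma>) = card \<tau>'"
          using \<sigma>(1) upper_facesE(1)[OF \<tau>'] by (simp add: faces_def)
      qed
      then have ins: "insert j ?\<sigma> = \<tau>'" "?\<sigma> - {j} = ?\<sigma>" "insert j ?\<sigma> - {j} = ?\<sigma>" using j by auto
      \<comment> \<open>Both faces are matched at steps not before j, the least step in S. So both
        were free when step j was reached, and the edge between them had to be selected.\<close>
      have "\<not> matched ms k ?\<sigma> \<and> \<not> matched ms k \<tau>'" if "k < j" for k
      proof -
        have "k < step_of ms \<tau>" "k < step_of ms \<tau>'"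
          using min[OF \<open>\<tau> \<in> S\<close>] min[OF \<open>\<tau>' \<in> S\<close>] that by simp_all
        then show ?thesis
          using matched_unique[OF _ \<sigma>(3), of k] matched_unique[OF _ upper_facesE(5)[OF \<tau>'], of k] by auto
      qed
      moreover have "\<tau>' - {j} \<subseteq> {..<length ms}"
        using \<sigma>(1) ins(1) by (auto simp: faces_def)
      moreover have "lcm_mon ms ?\<sigma> = lcm_mon ms \<tau>'" using \<sigma>(2) upper_facesE(2)[OF \<tau>'] by simp
      ultimately have "matched ms j ?\<sigma>"
        unfolding matched_iff[of ms j ?\<sigma>] ins(2,3) ins(1) by blast
      then have "step_of ms \<tau> = j" using matched_unique \<sigma>(3) by blast
      then have "insert j ?\<sigma> = \<tau>" using upper_facesE(4)[OF \<tau>] by blast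
      then show False using ins(1) that(3) by simp
    qed
    \<comment> \<open>Faces of S avoiding j have their successors among themselves, so by induction
      there are none. The successor of \<open>\<tau>0\<close> then contains j, although the lower
      end of \<open>\<tau>0\<close> does not.\<close>
    let ?S = "{\<tau> \<in> S. j \<notin> \<tau>}"
    have "?S = {}"
    proof (rule less.hyps)
      have "\<tau>0 \<notin> ?S" using \<tau>0 upper_facesE(4) less.prems(2) by blast
      then have "?S \<subset> S" using \<tau>0(1) by blast
      then show "card ?S < card S" using less.prems(1) by (rule psubset_card_mono[rotated])
      show "finite ?S" "?S \<subseteq> upper_faces ms i \<alpha>" using less.prems(1,2) by auto
      fix \<tau> assume "\<tau> \<in> ?S"
      then have \<tau>: "\<tau> \<in> S" "j \<notin> \<tau>" by blast+
      obtain \<tau>' where \<tau>': "\<tau>' \<in> S" "\<tau>' \<noteq> \<tau>" "\<tau> - {step_of ms \<tau>} \<subseteq> \<tau>'"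
        using less.prems(3)[OF \<tau>(1)] by blast
      then have "j \<notin> \<tau>'" using no_entry[OF \<tau>(1) \<tau>'] \<tau>(2) by blast
      then show "\<exists>\<tau>'\<in>?S. \<tau>' \<noteq> \<tau> \<and> \<tau> - {step_of ms \<tau>} \<subseteq> \<tau>'" using \<tau>' by blast
    qed
    moreover obtain \<tau>' where \<tau>': "\<tau>' \<in> S" "\<tau>' \<noteq> \<tau>0" "\<tau>0 - {step_of ms \<tau>0} \<subseteq> \<tau>'"
      using less.prems(3)[OF \<tau>0(1)] by blast
    ultimately have "j \<in> \<tau>'" by blast
    from no_entry[OF \<tau>0(1) \<tau>' this] show False using \<tau>0(2) by blast
  qed
qed

section \<open>Rank bounds from the matching\<close>

lemma taylor_basis_at: "basis_at (taylor ms) i \<alpha> = set_encode ` faces_at ms i \<alpha>"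
  unfolding basis_at_def faces_at_def taylor_basis taylor_mdeg by (auto simp: set_decode_encode_face)

lemma card_taylor_basis_at: "card (basis_at (taylor ms) i \<alpha>) = card (faces_at ms i \<alpha>)"
  unfolding taylor_basis_at
  by (rule card_image) (rule inj_on_subset[OF inj_on_faces], auto simp: faces_at_def)

lemma taylor_basis_at_iff: "e \<in> basis_at (taylor ms) i \<alpha> \<longleftrightarrow> set_decode e \<in> faces_at ms i \<alpha>"
  by (simp add: basis_at_def faces_at_def taylor_basis_iff taylor_mdeg)

lemma taylor_tor_bd:
  fixes ms :: "('n::finite) mon list" and v :: "nat \<Rightarrow> 'k::field"
  defines "T \<equiv> taylor ms :: ('n, 'k) graded_complex"
  shows "tor_bd T i \<alpha> v a = (if a \<in> basis_at T i \<alpha> then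
     (\<Sum>b\<in>basis_at T (Suc i) \<alpha>. (if set_decode a \<subseteq> set_decode b
       then face_sign (the_elem (set_decode b - set_decode a)) (set_decode a) else 0) * v b) else 0)"
proof (cases "a \<in> basis_at T i \<alpha>")
  case True
  have "Poly_Mapping.lookup (bd T i a b) 0 = (if set_decode a \<subseteq> set_decode b
       then face_sign (the_elem (set_decode b - set_decode a)) (set_decode a) else 0)"
    if "b \<in> basis_at T (Suc i) \<alpha>" for b
    using True that by (simp add: basis_at_def taylor_mdeg T_def) (simp add: taylor_def)
  then show ?thesis using True by (simp add: tor_bd_def)
qed (simp add: tor_bd_def)

lemma finite_taylor_basis_at: "finite (basis_at (taylor ms) i \<alpha>)"
  unfolding taylor_basis_at using finite_faces_at by blast

text \<open>The boundaries of the upper ends in S are independent modulo W: coordinates at the lower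
  ends ignore W, and on these coordinates acyclicity makes the matrix triangular. It is applied with
  W = {0} to compare edges with ranks, and with the boundaries of J for the block
  decomposition.\<close>

lemma tor_boundaries_dim_ge:
  fixes W :: "(nat \<Rightarrow> 'k::field) set" and ms :: "('n::finite) mon list"
  assumes W: "fv.subspace W" "W \<subseteq> tor_boundaries (taylor ms :: ('n, 'k) graded_complex) i \<alpha>"
    and S: "S \<subseteq> upper_faces ms i \<alpha>"
    and vanish: "\<And>w \<tau>. w \<in> W \<Longrightarrow> \<tau> \<in> S \<Longrightarrow> w (set_encode (\<tau> - {step_of ms \<tau>})) = 0"
  shows "fv.dim W + card S \<le> fv.dim (tor_boundaries (taylor ms :: ('n, 'k) graded_complex) i \<alpha>)"
proof -
  let ?T = "taylor ms :: ('n, 'k) graded_complex"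
  let ?x = "\<lambda>\<tau>. tor_bd ?T i \<alpha> (unit_vec (set_encode \<tau>))"
  have up: "set_encode \<tau> \<in> basis_at ?T (Suc i) \<alpha>" if "\<tau> \<in> upper_faces ms i \<alpha>" for \<tau>
    unfolding taylor_basis_at using upper_facesE(1,2)[OF that] by (auto simp: faces_at_def)
  have finS: "finite S"
    by (rule finite_subset[OF S]) (simp add: upper_faces_def finite_faces)
  have entry: "?x \<tau>' (set_encode (\<tau> - {step_of ms \<tau>})) = (if \<tau> - {step_of ms \<tau>} \<subseteq> \<tau>'
      then face_sign (the_elem (\<tau>' - (\<tau> - {step_of ms \<tau>}))) (\<tau> - {step_of ms \<tau>}) else 0)"
    if "\<tau> \<in> S" "\<tau>' \<in> S" for \<tau> \<tau>'
  proof -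
    let ?\<sigma> = "\<tau> - {step_of ms \<tau>}"
    have \<tau>: "\<tau> \<in> upper_faces ms i \<alpha>" and \<tau>': "\<tau>' \<in> upper_faces ms i \<alpha>" using that S by blast+
    have \<sigma>: "?\<sigma> \<in> faces_at ms i \<alpha>"
      using upper_faces_remove(1,2)[OF \<tau>] by (simp add: faces_at_def)
    then have dec: "set_decode (set_encode ?\<sigma>) = ?\<sigma>" "set_decode (set_encode \<tau>') = \<tau>'"
      using upper_facesE(1)[OF \<tau>'] by (auto simp: faces_at_def set_decode_encode_face)
    have a: "set_encode ?\<sigma> \<in> basis_at ?T i \<alpha>" unfolding taylor_basis_at using \<sigma> by (rule imageI)
    define c where "c b = (if ?\<sigma> \<subseteq> set_decode b
      then face_sign (the_elem (set_decode b - ?\<sigma>)) ?\<sigma> else 0 :: 'k)" for b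
    have "?x \<tau>' (set_encode ?\<sigma>) = (\<Sum>b\<in>basis_at ?T (Suc i) \<alpha>. c b * unit_vec (set_encode \<tau>') b)"
      unfolding taylor_tor_bd dec(1) c_def using a by simp
    also have "\<dots> = (\<Sum>b\<in>{set_encode \<tau>'}. c b * unit_vec (set_encode \<tau>') b)"
      using up[OF \<tau>'] finite_taylor_basis_at by (intro sum.mono_neutral_right) (auto simp: unit_vec_def)
    also have "\<dots> = c (set_encode \<tau>')" by (simp add: unit_vec_def)
    finally show ?thesis by (simp only: c_def dec(2))
  qed
  show ?thesis
  proof (rule fv.dim_relative_le[OF W _ _ finS, where x = ?x])
    show "tor_boundaries ?T i \<alpha> \<subseteq> fv.span (unit_vec ` basis_at ?T i \<alpha>)"
      using supported_on_span[OF finite_taylor_basis_at] tor_bd_chains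
      unfolding tor_boundaries_def tor_chains_eq by blast
    show "finite (unit_vec ` basis_at ?T i \<alpha>)" using finite_taylor_basis_at by blast
    show "?x ` S \<subseteq> tor_boundaries ?T i \<alpha>"
    proof (rule image_subsetI)
      fix \<tau> assume "\<tau> \<in> S"
      then have "unit_vec (set_encode \<tau>) \<in> tor_chains ?T (Suc i) \<alpha>"
        using up S by (auto simp: tor_chains_def unit_vec_def)
      then show "?x \<tau> \<in> tor_boundaries ?T i \<alpha>" unfolding tor_boundaries_def by (rule imageI)
    qed
    fix a :: "nat set \<Rightarrow> 'k"
    assume sum: "(\<Sum>\<tau>\<in>S. (\<lambda>e. a \<tau> * ?x \<tau> e)) \<in> W"
    \<comment> \<open>The support of a relation modulo W would be a set of upper ends in which every
      element has a successor.\<close>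
    have "{\<tau> \<in> S. a \<tau> \<noteq> 0} = {}"
    proof (rule matching_acyclic)
      show "finite {\<tau> \<in> S. a \<tau> \<noteq> 0}" "{\<tau> \<in> S. a \<tau> \<noteq> 0} \<subseteq> upper_faces ms i \<alpha>"
        using finS S by auto
      fix \<tau> assume "\<tau> \<in> {\<tau> \<in> S. a \<tau> \<noteq> 0}"
      then have \<tau>: "\<tau> \<in> S" "a \<tau> \<noteq> 0" by blast+
      let ?\<sigma> = "\<tau> - {step_of ms \<tau>}"
      show "\<exists>\<tau>'\<in>{\<tau> \<in> S. a \<tau> \<noteq> 0}. \<tau>' \<noteq> \<tau> \<and> ?\<sigma> \<subseteq> \<tau>'"
      proof (rule ccontr)
        assume no: "\<not> ?thesis"
        \<comment> \<open>Read the relation at the lower end of \<tau>. If no other face of the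
          support contains it, only the coefficient of \<tau> times a sign is left.\<close>
        have "0 = (\<Sum>\<tau>'\<in>S. a \<tau>' * ?x \<tau>' (set_encode ?\<sigma>))"
          using vanish[OF sum \<tau>(1)] unfolding sum_fun_apply by (rule sym)
        also have "\<dots> = (\<Sum>\<tau>'\<in>{\<tau>}. a \<tau>' * ?x \<tau>' (set_encode ?\<sigma>))"
        proof (intro sum.mono_neutral_right finS ballI)
          fix \<tau>' assume \<tau>': "\<tau>' \<in> S - {\<tau>}"
          then have "a \<tau>' = 0 \<or> \<not> ?\<sigma> \<subseteq> \<tau>'" using no by blast
          then show "a \<tau>' * ?x \<tau>' (set_encode ?\<sigma>) = 0"
            using entry[OF \<tau>(1), of \<tau>'] \<tau>' by auto
        qed (use \<tau> in simp)
        also have "\<dots> = a \<tau> * face_sign (the_elem (\<tau> - ?\<sigma>)) ?\<sigma>"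
          using entry[OF \<tau>(1) \<tau>(1)] by (simp add: Diff_subset)
        finally show False using \<tau>(2) by (simp add: face_sign_def)
      qed
    qed
    then show "\<forall>\<tau>\<in>S. a \<tau> = 0" by blast
  qed
qed

abbreviation taylor_rank :: "'k::field itself \<Rightarrow> ('n::finite) mon list \<Rightarrow> nat \<Rightarrow> 'n mon \<Rightarrow> nat" where
  "taylor_rank K ms i \<alpha> \<equiv> fv.dim (tor_boundaries (taylor ms :: ('n, 'k) graded_complex) i \<alpha>)"

lemma upper_faces_le_rank: "card (upper_faces ms i \<alpha>) \<le> taylor_rank TYPE('k::field) ms i \<alpha>"
proof -
  have "fv.dim {0::nat \<Rightarrow> 'k} + card (upper_faces ms i \<alpha>) \<le> taylor_rank TYPE('k) ms i \<alpha>"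
    using fv.subspace_0[OF subspace_tor_boundaries]
    by (intro tor_boundaries_dim_ge) auto
  then show ?thesis by simp
qed

text \<open>Replaces Betti numbers by ranks. For ranks, I and J can be compared directly, because
  the boundaries for J lie among those for I.\<close>

lemma pruned_resolution_minimal_iff:
  fixes I :: "('n::finite, 'k::field) mpol set"
  assumes I: "I = monomial_ideal (set ms)"
  shows "pruned_resolution_minimal ms I \<longleftrightarrow>
    (\<forall>i \<alpha>. card (upper_faces ms i \<alpha>) = taylor_rank TYPE('k) ms i \<alpha>)"
proof -
  let ?T = "taylor ms :: ('n, 'k) graded_complex"
  let ?c = "\<lambda>i \<alpha>. card (critical_at ms i \<alpha>)" and ?e = "\<lambda>i \<alpha>. card (upper_faces ms i \<alpha>)"
    and ?r = "\<lambda>i \<alpha>. taylor_rank TYPE('k) ms i \<alpha>"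
  have betti: "betti I i \<alpha> = tor_dim ?T i \<alpha>" for i \<alpha>
    using betti_eq_tor_dim[OF _ I] taylor_resolution I by metis
  have t0: "tor_dim ?T 0 \<alpha> + ?r 0 \<alpha> = ?c 0 \<alpha> + ?e 0 \<alpha>" for \<alpha>
    using dim_tor_cycles(1)[OF taylor_strandwise_exact[where 'b = 'k], of ms \<alpha>] card_faces_at(1)[of ms \<alpha>]
    by (simp add: card_taylor_basis_at)
  have t1: "tor_dim ?T (Suc i) \<alpha> + ?r i \<alpha> + ?r (Suc i) \<alpha> = ?c (Suc i) \<alpha> + ?e i \<alpha> + ?e (Suc i) \<alpha>" for i \<alpha>
    using dim_tor_cycles(2)[OF taylor_strandwise_exact[where 'b = 'k], of ms i \<alpha>] card_faces_at(2)[of ms i \<alpha>]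
    by (simp add: card_taylor_basis_at)
  have le: "?e i \<alpha> \<le> ?r i \<alpha>" for i \<alpha> by (rule upper_faces_le_rank)
  have "pruned_resolution_minimal ms I \<longleftrightarrow> (\<forall>i \<alpha>. ?c i \<alpha> = tor_dim ?T i \<alpha>)"
    unfolding pruned_resolution_minimal_def critical_at_def[symmetric] betti ..
  also have "\<dots> \<longleftrightarrow> (\<forall>i \<alpha>. ?e i \<alpha> = ?r i \<alpha>)"
  proof (intro iffI allI)
    fix i \<alpha> assume c: "\<forall>i \<alpha>. ?c i \<alpha> = tor_dim ?T i \<alpha>"
    show "?e i \<alpha> = ?r i \<alpha>"
    proof (cases i)
      case 0
      have "?c 0 \<alpha> = tor_dim ?T 0 \<alpha>" using c by blast
      then show ?thesis using t0[of \<alpha>] unfolding 0 by linarith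
    next
      case (Suc j)
      have "?c (Suc j) \<alpha> = tor_dim ?T (Suc j) \<alpha>" using c by blast
      then show ?thesis using t1[of j \<alpha>] le[of j \<alpha>] le[of "Suc j" \<alpha>] unfolding Suc by linarith
    qed
  next
    fix i \<alpha> assume e: "\<forall>i \<alpha>. ?e i \<alpha> = ?r i \<alpha>"
    show "?c i \<alpha> = tor_dim ?T i \<alpha>"
    proof (cases i)
      case 0
      have "?e 0 \<alpha> = ?r 0 \<alpha>" using e by blast
      then show ?thesis using t0[of \<alpha>] unfolding 0 by linarith
    next
      case (Suc j)
      have "?e j \<alpha> = ?r j \<alpha>" "?e (Suc j) \<alpha> = ?r (Suc j) \<alpha>" using e by blast+
      then show ?thesis using t1[of j \<alpha>] unfolding Suc by linarith
    qed
  qed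
  finally show ?thesis .
qed

section \<open>Deleting the last generator\<close>

lemma lcm_mon_butlast:
  assumes "\<sigma> \<subseteq> {..<length ms - 1}"
  shows "lcm_mon (butlast ms) \<sigma> = lcm_mon ms \<sigma>"
proof -
  have "(\<lambda>i. Poly_Mapping.lookup (butlast ms ! i) x) ` \<sigma> = (\<lambda>i. Poly_Mapping.lookup (ms ! i) x) ` \<sigma>" for x
    using assms by (intro image_cong refl) (auto simp: nth_butlast)
  then show ?thesis
    by (intro poly_mapping_eqI) (simp add: lookup_lcm_mon)
qed

text \<open>Selection at step k depends only on earlier steps at \<open>\<tau> - {k}\<close> and
  \<open>insert k \<tau>\<close>, and both avoid the last index when \<tau> does.\<close>

lemma matched_butlast:
  assumes "k < length ms - 1" "\<tau> \<subseteq> {..<length ms - 1}"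
  shows "matched (butlast ms) k \<tau> \<longleftrightarrow> matched ms k \<tau>"
  using assms
proof (induction k arbitrary: \<tau> rule: less_induct)
  case (less k)
  let ?\<rho> = "insert k \<tau>" and ?\<sigma> = "\<tau> - {k}"
  have sub: "?\<rho> \<subseteq> {..<length ms - 1}" "?\<sigma> \<subseteq> {..<length ms - 1}"
    using less.prems by auto
  have "matched (butlast ms) l ?\<rho> \<longleftrightarrow> matched ms l ?\<rho>" "matched (butlast ms) l ?\<sigma> \<longleftrightarrow> matched ms l ?\<sigma>"
    if "l < k" for l
    using less.IH[OF that] less.prems(1) that sub by simp_all
  moreover have "lcm_mon (butlast ms) ?\<rho> = lcm_mon ms ?\<rho>" "lcm_mon (butlast ms) ?\<sigma> = lcm_mon ms ?\<sigma>"
    using sub by (simp_all only: lcm_mon_butlast)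
  moreover have "?\<rho> - {k} \<subseteq> {..<length (butlast ms)}" "?\<rho> - {k} \<subseteq> {..<length ms}"
    using sub(1) by auto
  ultimately show ?case
    unfolding matched_iff[of "butlast ms" k \<tau>] matched_iff[of ms k \<tau>] by metis
qed

lemma faces_at_butlast: "\<sigma> \<in> faces_at (butlast ms) i \<alpha> \<longleftrightarrow> \<sigma> \<in> faces_at ms i \<alpha> \<and> \<sigma> \<subseteq> {..<length ms - 1}"
proof -
  have "\<sigma> \<subseteq> {..<length ms}" if "\<sigma> \<subseteq> {..<length ms - 1}" using that by auto
  then show ?thesis
    using lcm_mon_butlast[of \<sigma> ms] by (auto simp: faces_at_def faces_def)
qed

text \<open>Face codes do not depend on the generators, so the chains for J are literally chains for
  I. Faces avoiding the last index are closed under subsets, so their boundaries have no coordinates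
  at faces containing it.\<close>

lemma tor_boundaries_butlast:
  "tor_boundaries (taylor (butlast ms) :: ('n::finite, 'k::field) graded_complex) i \<alpha> \<subseteq>
    tor_boundaries (taylor ms) i \<alpha>"
proof -
  let ?T = "taylor ms :: ('n, 'k) graded_complex" and ?T' = "taylor (butlast ms) :: ('n, 'k) graded_complex"
  have sub: "basis_at ?T' i \<alpha> \<subseteq> basis_at ?T i \<alpha>" for i
    using taylor_basis_at_iff faces_at_butlast by blast
  have "tor_bd ?T' i \<alpha> v = tor_bd ?T i \<alpha> v" if v: "v \<in> tor_chains ?T' (Suc i) \<alpha>" for v
  proof
    fix a
    define c where "c b = (if set_decode a \<subseteq> set_decode b
      then face_sign (the_elem (set_decode b - set_decode a)) (set_decode a) else 0 :: 'k)" for b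
    have eq: "(\<Sum>b\<in>basis_at ?T (Suc i) \<alpha>. c b * v b) = (\<Sum>b\<in>basis_at ?T' (Suc i) \<alpha>. c b * v b)"
      using sub v finite_taylor_basis_at by (intro sum.mono_neutral_right) (auto simp: tor_chains_def)
    have "(\<Sum>b\<in>basis_at ?T' (Suc i) \<alpha>. c b * v b) = 0"
      if "a \<in> basis_at ?T i \<alpha>" "a \<notin> basis_at ?T' i \<alpha>"
    proof (rule sum.neutral, rule ballI)
      fix b assume "b \<in> basis_at ?T' (Suc i) \<alpha>"
      then have "set_decode b \<subseteq> {..<length ms - 1}"
        using taylor_basis_at_iff faces_at_butlast by blast
      moreover have "\<not> set_decode a \<subseteq> {..<length ms - 1}"
        using that taylor_basis_at_iff faces_at_butlast by blast
      ultimately show "c b * v b = 0" unfolding c_def by auto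
    qed
    then show "tor_bd ?T' i \<alpha> v a = tor_bd ?T i \<alpha> v a"
      unfolding taylor_tor_bd c_def[symmetric] eq
      using sub[of i] by (cases "a \<in> basis_at ?T i \<alpha>"; cases "a \<in> basis_at ?T' i \<alpha>") auto
  qed
  moreover have "tor_chains ?T' (Suc i) \<alpha> \<subseteq> tor_chains ?T (Suc i) \<alpha>"
    using sub unfolding tor_chains_def by blast
  ultimately show ?thesis unfolding tor_boundaries_def by (auto intro: image_eqI)
qed

text \<open>If a proper subset S generated J, then S together with the last generator would generate
  I with too few monomials.\<close>

lemma minimal_generators_butlast:
  fixes I :: "('n, 'k::field) mpol set"
  assumes "ms \<noteq> []" and I: "minimal_generators ms I"
  shows "minimal_generators (butlast ms) (monomial_ideal (set (butlast ms)) :: ('n, 'k) mpol set)"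
proof -
  let ?g = "\<lambda>t. Poly_Mapping.single t (1::'k)"
  have ms: "set ms = insert (last ms) (set (butlast ms))"
    using append_butlast_last_id[OF assms(1)] by (metis Un_insert_right list.simps(15) set_append sup_bot_right empty_set)
  have "distinct (butlast ms @ [last ms])"
    using I append_butlast_last_id[OF assms(1)] by (simp add: minimal_generators_def)
  then have dist: "distinct (butlast ms)" "last ms \<notin> set (butlast ms)" by auto
  have "monomial_ideal S \<noteq> (monomial_ideal (set (butlast ms)) :: ('n, 'k) mpol set)"
    if S: "S \<subset> set (butlast ms)" for S
  proof
    assume eq: "monomial_ideal S = (monomial_ideal (set (butlast ms)) :: ('n, 'k) mpol set)"
    \<comment> \<open>Membership after adjoining a generator depends on A only through the ideal it
      generates, so \<open>eq\<close> can be substituted.\<close>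
    have mem: "p \<in> monomial_ideal (insert (last ms) A) \<longleftrightarrow>
        (\<exists>k. p - k * ?g (last ms) \<in> monomial_ideal A)" for A and p :: "('n, 'k) mpol"
      unfolding monomial_ideal_def image_insert by (rule module.span_breakdown_eq[OF module_mpol])
    have "monomial_ideal (insert (last ms) S) = (monomial_ideal (set ms) :: ('n, 'k) mpol set)"
      unfolding ms by (intro set_eqI) (simp only: mem eq)
    moreover obtain t where t: "t \<in> set (butlast ms)" "t \<notin> S" using S by blast
    moreover have "t \<noteq> last ms" using t(1) dist(2) by metis
    then have "insert (last ms) S \<subset> set ms" unfolding ms using S t by auto
    ultimately show False using I unfolding minimal_generators_def by simp
  qed
  then show ?thesis using dist(1) by (simp add: minimal_generators_def)
qed

theorem proposition3p8:
  fixes I J :: "(('n::finite \<Rightarrow>\<^sub>0 nat) \<Rightarrow>\<^sub>0 'k::field) set"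
    and ms :: "('n \<Rightarrow>\<^sub>0 nat) list"
  assumes "ms \<noteq> []"
    and "minimal_generators ms I"
    and "J = monomial_ideal (set (butlast ms))"
    and "pruned_resolution_minimal ms I"
    and "prune_step ms (length ms - 1) = {}"
  shows "has_minimal_pruned_resolution J"
proof -
  let ?q = "length ms - 1" and ?ms = "butlast ms"
  have "I = monomial_ideal (set ms)" using assms(2) by (simp add: minimal_generators_def)
  then have rank_I: "card (upper_faces ms i \<alpha>) = taylor_rank TYPE('k) ms i \<alpha>" for i \<alpha>
    using assms(4) pruned_resolution_minimal_iff by blast
  have last: "\<not> matched ms ?q \<tau>" for \<tau> using assms(5) by (simp add: matched_def)
  have "card (upper_faces ?ms i \<alpha>) = taylor_rank TYPE('k) ?ms i \<alpha>" for i \<alpha>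
  proof (rule antisym)
    show "card (upper_faces ?ms i \<alpha>) \<le> taylor_rank TYPE('k) ?ms i \<alpha>"
      by (rule upper_faces_le_rank)
    \<comment> \<open>The index \<open>?q\<close> is the last one, counted from 0; these upper ends
      represent the edges that J does not see.\<close>
    let ?Q = "{\<tau> \<in> upper_faces ms i \<alpha>. ?q \<in> \<tau>}"
    have "taylor_rank TYPE('k) ?ms i \<alpha> + card ?Q \<le> taylor_rank TYPE('k) ms i \<alpha>"
    proof (rule tor_boundaries_dim_ge[OF subspace_tor_boundaries tor_boundaries_butlast])
      fix w :: "nat \<Rightarrow> 'k" and \<tau>
      assume w: "w \<in> tor_boundaries (taylor ?ms) i \<alpha>" and \<tau>: "\<tau> \<in> ?Q"
      let ?\<sigma> = "\<tau> - {step_of ms \<tau>}"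
      have up: "\<tau> \<in> upper_faces ms i \<alpha>" using \<tau> by blast
      \<comment> \<open>Here the emptiness of the last step enters: the vertex removed from \<tau>
        is not the last one, so the lower end still contains it.\<close>
      have "?q \<noteq> step_of ms \<tau>" using upper_facesE(5)[OF up] last by metis
      then have "\<not> ?\<sigma> \<subseteq> {..<?q}" using \<tau> by auto
      moreover have "set_decode (set_encode ?\<sigma>) = ?\<sigma>"
        by (rule set_decode_encode_face[OF upper_faces_remove(1)[OF up]])
      ultimately have "set_encode ?\<sigma> \<notin> basis_at (taylor ?ms) i \<alpha>"
        unfolding taylor_basis_at_iff faces_at_butlast by simp
      moreover have "w \<in> tor_chains (taylor ?ms) i \<alpha>"
        using w tor_bd_chains unfolding tor_boundaries_def by blast
      ultimately show "w (set_encode ?\<sigma>) = 0" unfolding tor_chains_def by blast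
    qed blast
    \<comment> \<open>An upper end without the last index was matched by an earlier vertex, and the
      same edge is selected for J.\<close>
    moreover have "upper_faces ms i \<alpha> \<subseteq> upper_faces ?ms i \<alpha> \<union> ?Q"
    proof
      fix \<tau> assume \<tau>: "\<tau> \<in> upper_faces ms i \<alpha>"
      note u = upper_facesE[OF \<tau>]
      show "\<tau> \<in> upper_faces ?ms i \<alpha> \<union> ?Q"
      proof (cases "?q \<in> \<tau>")
        case False
        have "\<tau> \<subseteq> {..<?q}"
        proof
          fix x assume x: "x \<in> \<tau>"
          then have "x < length ms" using u(1) by (auto simp: faces_def)
          moreover have "x \<noteq> ?q" using x False by blast
          ultimately show "x \<in> {..<?q}" by simp
        qed
        then have "\<tau> \<in> faces_at ?ms (Suc i) \<alpha>"
          using u(1,2) by (simp add: faces_at_butlast) (simp add: faces_at_def)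
        moreover have j: "step_of ms \<tau> < ?q" using \<open>\<tau> \<subseteq> {..<?q}\<close> u(4) by blast
        moreover have "matched ?ms (step_of ms \<tau>) \<tau>"
          using u(5) matched_butlast[OF j \<open>\<tau> \<subseteq> {..<?q}\<close>] by blast
        ultimately show ?thesis
          using u(4) by (auto simp: upper_faces_def faces_at_def)
      qed (use \<tau> in blast)
    qed
    moreover have "finite (upper_faces ?ms i \<alpha> \<union> ?Q)"
      by (simp add: upper_faces_def finite_faces)
    \<comment> \<open>For I the rank equals the number of edges, hence is at most the number of
      edges for J plus \<open>card ?Q\<close>; it is also at least the rank for J plus
      \<open>card ?Q\<close>.\<close>
    ultimately have "taylor_rank TYPE('k) ms i \<alpha> \<le> card (upper_faces ?ms i \<alpha> \<union> ?Q)"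
      unfolding rank_I[symmetric] by (intro card_mono)
    also have "\<dots> \<le> card (upper_faces ?ms i \<alpha>) + card ?Q" by (rule card_Un_le)
    finally show "taylor_rank TYPE('k) ?ms i \<alpha> \<le> card (upper_faces ?ms i \<alpha>)"
      using \<open>taylor_rank TYPE('k) ?ms i \<alpha> + card ?Q \<le> taylor_rank TYPE('k) ms i \<alpha>\<close> by linarith
  qed
  then have "pruned_resolution_minimal ?ms J"
    using pruned_resolution_minimal_iff[OF assms(3)] by blast
  moreover have "minimal_generators ?ms J"
    unfolding assms(3) by (rule minimal_generators_butlast[OF assms(1,2)])
  ultimately show ?thesis unfolding has_minimal_pruned_resolution_def by blast
qed

end
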